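(* Let $d\in\mathbb{N}\cup\{\infty\}$ and let $X=\{x_1,\dots,x_n\}$ be a finite subset of $\mathbb{B}_d$ consisting of $n$ distinct points. Put $r:=\max_{i,j}\rho_{\rm ph}(x_i,x_j)$. There exists a constant $C>0$, depending only on $n$, $d$ and $r$, such that for any set $Y=\{y_1,\dots,y_n\}\subset\mathbb{B}_d$ of $n$ distinct points with $\delta_{RK}(\mathcal{H}_X,\mathcal{H}_Y)<2$, $$\tilde\rho_s(X,Y)\le C\,(\delta_{RK}(\mathcal{H}_X,\mathcal{H}_Y)-1)^{1/4},$$ where $\tilde\rho_s$ denotes the automorphism invariant symmetric distance induced by the pseudohyperbolic metric $\rho_{\rm ph}$.
   Context: $\mathbb{B}_d$ is the open unit ball of a complex $d$-dimensional Hilbert space. For $X\subseteq\mathbb{B}_d$, $\mathcal{H}_X$ is the reproducing kernel Hilbert space (RKHS) on $X$ with kernel $k(z,w)=\frac{1}{1-\langle z,w\rangle}$, $z,w\in X$ (the restriction to $X$ of the Drury-Arveson space). For RKHSs $\mathcal{H}_i$ on sets $X_i$ with kernel functions $k^i_x$ ($i=1,2$), an RKHS isomorphism is a bounded linear bijection $T:\mathcal{H}_1\to\mathcal{H}_2$ with $T(k^1_x)=\lambda_xk^2_{F(x)}$ for all $x\in X_1$, where $F:X_1\to X_2$ is a bijection and $x\mapsto\lambda_x\in\mathbb{C}$ is nowhere vanishing. Define $\delta_{RK}(\mathcal{H}_1,\mathcal{H}_2)=\inf\{\|T\|\|T^{-1}\|:T:\mathcal{H}_1\to\mathcal{H}_2\text{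 an RKHS isomorphism}\}$. The pseudohyperbolic metric on $\mathbb{B}_d$ is $\rho_{\rm ph}(z,w)=\|\Psi_w(z)\|$, where $\Psi_w(z)=\frac{w-P_wz-(1-\|w\|^2)^{1/2}P_w^\perp z}{1-\langle z,w\rangle}$, $P_w$ is the orthogonal projection onto the span of $w$ and $P_w^\perp=I-P_w$. For a metric $\rho$ on $\mathbb{B}_d$ and $n$-point sets $X=\{x_i\}$, $Y=\{y_i\}$, $\rho_s(X,Y)=\min_{\sigma\in S_n}\max_i\rho(x_i,y_{\sigma(i)})$ and $\tilde\rho_s(X,Y)=\inf\{\rho_s(X,\Phi(Y)):\Phi\in\operatorname{Aut}(\mathbb{B}_d)\}$, where $\operatorname{Aut}(\mathbb{B}_d)$ is the group of biholomorphic automorphisms of $\mathbb{B}_d$. *)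

theory Defs
  imports
    "HOL-Analysis.Analysis"
    "HOL-Combinatorics.Permutations"
    "HOL-Library.Extended_Real"
begin

section \<open>The Hilbert space of square-summable families\<close>

text \<open>
  For a countable index type \<open>'d\<close> this is the complex Hilbert space of dimension \<open>CARD('d)\<close>
  if \<open>'d\<close> is finite, and the separable infinite-dimensional one otherwise.
\<close>

typedef 'd ell2 = "{f :: 'd \<Rightarrow> complex. (\<lambda>i. (cmod (f i))\<^sup>2) summable_on UNIV}"
  morphisms coord Abs_ell2
  by (rule exI[of _ "\<lambda>_. 0"]) simp

setup_lifting type_definition_ell2

lemma coord_sq_summable: "(\<lambda>i. (cmod (coord x i))\<^sup>2) summable_on UNIV"
  using coord[of x] by simp

lemma ell2_eqI: "(\<And>i. coord x i = coord y i) \<Longrightarrow> x = y"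
  by (metis coord_inject ext)

lemma sq_summable_add:
  fixes f g :: "'d \<Rightarrow> complex"
  assumes "(\<lambda>i. (cmod (f i))\<^sup>2) summable_on UNIV" "(\<lambda>i. (cmod (g i))\<^sup>2) summable_on UNIV"
  shows "(\<lambda>i. (cmod (f i + g i))\<^sup>2) summable_on UNIV"
proof (rule summable_on_comparison_test)
  show "(\<lambda>i. 2 * (cmod (f i))\<^sup>2 + 2 * (cmod (g i))\<^sup>2) summable_on UNIV"
    by (intro summable_on_add summable_on_cmult_right assms)
  fix i
  have "(cmod (f i + g i))\<^sup>2 \<le> (cmod (f i) + cmod (g i))\<^sup>2"
    by (intro power_mono norm_triangle_ineq) auto
  also have "\<dots> \<le> 2 * (cmod (f i))\<^sup>2 + 2 * (cmod (g i))\<^sup>2"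
    using sum_squares_bound[of "cmod (f i)" "cmod (g i)"] by (simp add: power2_sum)
  finally show "(cmod (f i + g i))\<^sup>2 \<le> 2 * (cmod (f i))\<^sup>2 + 2 * (cmod (g i))\<^sup>2" .
qed auto

lemma sq_summable_scale:
  fixes f :: "'d \<Rightarrow> complex"
  assumes "(\<lambda>i. (cmod (f i))\<^sup>2) summable_on UNIV"
  shows "(\<lambda>i. (cmod (c * f i))\<^sup>2) summable_on UNIV"
  unfolding norm_mult power_mult_distrib by (intro summable_on_cmult_right assms)

lift_definition scaleC :: "complex \<Rightarrow> 'd ell2 \<Rightarrow> 'd ell2" (infixr "*\<^sub>C" 75)
  is "\<lambda>c f i. c * f i" by (rule sq_summable_scale)

text \<open>The inner product is linear in its first argument.\<close>

definition cinner :: "'d ell2 \<Rightarrow> 'd ell2 \<Rightarrow> complex" where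
  "cinner x y = (\<Sum>\<^sub>\<infinity>i. coord x i * cnj (coord y i))"

lemma cinner_summable: "(\<lambda>i. coord x i * cnj (coord y i)) summable_on UNIV"
proof (rule abs_summable_summable, rule summable_on_comparison_test)
  show "(\<lambda>i. (cmod (coord x i))\<^sup>2 + (cmod (coord y i))\<^sup>2) summable_on UNIV"
    by (intro summable_on_add coord_sq_summable)
  fix i
  show "norm (coord x i * cnj (coord y i)) \<le> (cmod (coord x i))\<^sup>2 + (cmod (coord y i))\<^sup>2"
    using sum_squares_bound[of "cmod (coord x i)" "cmod (coord y i)"]
      mult_nonneg_nonneg[of "cmod (coord x i)" "cmod (coord y i)"]
    by (simp add: norm_mult del: mult_nonneg_nonneg)
qed auto

instantiation ell2 :: (type) real_vector
begin

lift_definition zero_ell2 :: "'a ell2" is "\<lambda>_. 0" by simp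
lift_definition plus_ell2 :: "'a ell2 \<Rightarrow> 'a ell2 \<Rightarrow> 'a ell2" is "\<lambda>f g i. f i + g i"
  by (rule sq_summable_add)
lift_definition uminus_ell2 :: "'a ell2 \<Rightarrow> 'a ell2" is "\<lambda>f i. - f i" by simp
lift_definition minus_ell2 :: "'a ell2 \<Rightarrow> 'a ell2 \<Rightarrow> 'a ell2" is "\<lambda>f g i. f i - g i"
  using sq_summable_add[of _ "\<lambda>i. - g i" for g] by fastforce
definition scaleR_ell2 :: "real \<Rightarrow> 'a ell2 \<Rightarrow> 'a ell2" where
  "scaleR_ell2 c x = complex_of_real c *\<^sub>C x"

instance
  by standard
    (auto intro!: ell2_eqI simp: scaleR_ell2_def plus_ell2.rep_eq zero_ell2.rep_eq
      uminus_ell2.rep_eq minus_ell2.rep_eq scaleC.rep_eq algebra_simps)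

end

lemma cinner_add_left: "cinner (x + y) z = cinner x z + cinner y z"
  by (simp add: cinner_def plus_ell2.rep_eq distrib_right infsum_add cinner_summable)

lemma cinner_scaleC_left: "cinner (c *\<^sub>C x) y = c * cinner x y"
  by (simp add: cinner_def scaleC.rep_eq mult.assoc infsum_cmult_right')

lemma cinner_commute: "cinner x y = cnj (cinner y x)"
  by (simp add: cinner_def flip: infsum_cnj) (simp add: mult.commute)

lemma cinner_self: "cinner x x = complex_of_real (\<Sum>\<^sub>\<infinity>i. (cmod (coord x i))\<^sup>2)"
proof -
  have "((\<lambda>i. complex_of_real ((cmod (coord x i))\<^sup>2)) has_sum
      complex_of_real (\<Sum>\<^sub>\<infinity>i. (cmod (coord x i))\<^sup>2)) UNIV"
    by (intro has_sum_bounded_linear[OF bounded_linear_of_real] has_sum_infsum coord_sq_summable)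
  then show ?thesis
    unfolding cinner_def complex_norm_square by (rule infsumI)
qed

instantiation ell2 :: (type) real_inner
begin

definition inner_ell2 :: "'a ell2 \<Rightarrow> 'a ell2 \<Rightarrow> real" where
  "inner_ell2 x y = Re (cinner x y)"
definition norm_ell2 :: "'a ell2 \<Rightarrow> real" where
  "norm_ell2 x = sqrt (x \<bullet> x)"
definition sgn_ell2 :: "'a ell2 \<Rightarrow> 'a ell2" where
  "sgn_ell2 x = x /\<^sub>R norm x"
definition dist_ell2 :: "'a ell2 \<Rightarrow> 'a ell2 \<Rightarrow> real" where
  "dist_ell2 x y = norm (x - y)"
definition uniformity_ell2 :: "('a ell2 \<times> 'a ell2) filter" where
  "uniformity_ell2 = (INF e\<in>{0<..}. principal {(x, y). dist x y < e})"
definition open_ell2 :: "'a ell2 set \<Rightarrow> bool" where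
  "open_ell2 U \<longleftrightarrow> (\<forall>x\<in>U. eventually (\<lambda>(x', y). x' = x \<longrightarrow> y \<in> U) uniformity)"

instance
proof
  fix x y z :: "'a ell2" and r :: real
  show "x \<bullet> y = y \<bullet> x"
    by (metis cinner_commute complex_cnj(1) complex.sel(1) complex_surj inner_ell2_def)
  show "(x + y) \<bullet> z = x \<bullet> z + y \<bullet> z"
    by (simp add: inner_ell2_def cinner_add_left)
  show "(r *\<^sub>R x) \<bullet> y = r * (x \<bullet> y)"
    by (simp add: inner_ell2_def scaleR_ell2_def cinner_scaleC_left)
  show "0 \<le> x \<bullet> x"
    by (simp add: inner_ell2_def cinner_self infsum_nonneg)
  show "(x \<bullet> x = 0) = (x = 0)"
  proof
    assume "x \<bullet> x = 0"
    then have "(\<Sum>\<^sub>\<infinity>i. (cmod (coord x i))\<^sup>2) = 0"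
      by (simp add: inner_ell2_def cinner_self)
    then have "(cmod (coord x i))\<^sup>2 = 0" for i
      using nonneg_infsum_le_0D[OF _ coord_sq_summable[of x], of i] by simp
    then show "x = 0"
      by (auto intro!: ell2_eqI simp: zero_ell2.rep_eq)
  next
    assume "x = 0"
    then show "x \<bullet> x = 0"
      by (simp add: inner_ell2_def cinner_self zero_ell2.rep_eq)
  qed
qed (simp_all only: norm_ell2_def sgn_ell2_def dist_ell2_def uniformity_ell2_def open_ell2_def)

end


section \<open>Automorphisms of the ball and the pseudohyperbolic metric\<close>

text \<open>
  Frechet differentiability with a complex linear derivative; \<open>has_derivative\<close> only makes \<open>D\<close>
  bounded and real linear.
\<close>

definition holomorphic_ell2 :: "('d ell2 \<Rightarrow> 'd ell2) \<Rightarrow> 'd ell2 set \<Rightarrow> bool" where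
  "holomorphic_ell2 f S \<longleftrightarrow>
     (\<forall>z\<in>S. \<exists>D. (f has_derivative D) (at z) \<and> (\<forall>c v. D (c *\<^sub>C v) = c *\<^sub>C D v))"

definition Aut_ball :: "('d ell2 \<Rightarrow> 'd ell2) set" where
  "Aut_ball = {\<Phi>. bij_betw \<Phi> (ball 0 1) (ball 0 1) \<and>
     holomorphic_ell2 \<Phi> (ball 0 1) \<and> holomorphic_ell2 (inv_into (ball 0 1) \<Phi>) (ball 0 1)}"

text \<open>For \<open>w = 0\<close> division by zero makes this the zero map, the projection onto the zero space.\<close>

definition proj :: "'d ell2 \<Rightarrow> 'd ell2 \<Rightarrow> 'd ell2" where
  "proj w z = (cinner z w / cinner w w) *\<^sub>C w"

lemma proj_orthogonal: "cinner (z - proj w z) w = 0"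
proof -
  have "cinner z w = cinner (z - proj w z) w + cinner (proj w z) w"
    by (simp flip: cinner_add_left)
  moreover have "cinner (proj w z) w = cinner z w"
  proof (cases "w = 0")
    case True
    then show ?thesis
      by (simp add: proj_def cinner_def zero_ell2.rep_eq)
  next
    case False
    then have "cinner w w \<noteq> 0"
      using inner_eq_zero_iff[of w] by (auto simp: inner_ell2_def)
    then show ?thesis
      by (simp add: proj_def cinner_scaleC_left)
  qed
  ultimately show ?thesis by simp
qed

definition Psi :: "'d ell2 \<Rightarrow> 'd ell2 \<Rightarrow> 'd ell2" where
  "Psi w z = (1 / (1 - cinner z w)) *\<^sub>C
     (w - proj w z - sqrt (1 - (norm w)\<^sup>2) *\<^sub>R (z - proj w z))"

definition rho_ph :: "'d ell2 \<Rightarrow> 'd ell2 \<Rightarrow> real" where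
  "rho_ph z w = norm (Psi w z)"

text \<open>
  The \<open>n\<close>-point sets are enumerated as \<open>x 0, \<dots>, x (n - 1)\<close> and \<open>y 0, \<dots>, y (n - 1)\<close>.
\<close>

definition sym_dist :: "('a \<Rightarrow> 'a \<Rightarrow> real) \<Rightarrow> nat \<Rightarrow> (nat \<Rightarrow> 'a) \<Rightarrow> (nat \<Rightarrow> 'a) \<Rightarrow> real" where
  "sym_dist \<rho> n x y =
     (MIN \<sigma>\<in>{\<sigma>. \<sigma> permutes {..<n}}. MAX i\<in>{..<n}. \<rho> (x i) (y (\<sigma> i)))"

definition aut_sym_dist ::
  "('d ell2 \<Rightarrow> 'd ell2 \<Rightarrow> real) \<Rightarrow> nat \<Rightarrow> (nat \<Rightarrow> 'd ell2) \<Rightarrow> (nat \<Rightarrow> 'd ell2) \<Rightarrow> real" where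
  "aut_sym_dist \<rho> n x y = (INF \<Phi>\<in>Aut_ball. sym_dist \<rho> n x (\<Phi> \<circ> y))"


section \<open>Reproducing kernel Hilbert spaces\<close>

text \<open>
  Functions on the set \<open>points H\<close> are represented by functions on the whole type that vanish
  outside \<open>points H\<close>. Only the values of \<open>kernel H\<close> on \<open>points H\<close> and those of \<open>ip H\<close> on
  \<open>elements H\<close> are meaningful.
\<close>

record 'a fun_space =
  points :: "'a set"
  kernel :: "'a \<Rightarrow> 'a \<Rightarrow> complex"
  elements :: "('a \<Rightarrow> complex) set"
  ip :: "('a \<Rightarrow> complex) \<Rightarrow> ('a \<Rightarrow> complex) \<Rightarrow> complex"

definition kernel_fun :: "'a fun_space \<Rightarrow> 'a \<Rightarrow> 'a \<Rightarrow> complex" where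
  "kernel_fun H x = (\<lambda>z. if z \<in> points H then kernel H z x else 0)"

definition hnorm :: "'a fun_space \<Rightarrow> ('a \<Rightarrow> complex) \<Rightarrow> real" where
  "hnorm H f = sqrt (Re (ip H f f))"

definition rkhs :: "'a fun_space \<Rightarrow> bool" where
  "rkhs H \<longleftrightarrow>
     (\<forall>f\<in>elements H. \<forall>z. z \<notin> points H \<longrightarrow> f z = 0) \<and>
     (\<lambda>_. 0) \<in> elements H \<and>
     (\<forall>f\<in>elements H. \<forall>g\<in>elements H. (\<lambda>z. f z + g z) \<in> elements H) \<and>
     (\<forall>c. \<forall>f\<in>elements H. (\<lambda>z. c * f z) \<in> elements H) \<and>
     (\<forall>f\<in>elements H. \<forall>g\<in>elements H. \<forall>h\<in>elements H.
        ip H (\<lambda>z. f z + g z) h = ip H f h + ip H g h) \<and>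
     (\<forall>c. \<forall>f\<in>elements H. \<forall>g\<in>elements H. ip H (\<lambda>z. c * f z) g = c * ip H f g) \<and>
     (\<forall>f\<in>elements H. \<forall>g\<in>elements H. ip H f g = cnj (ip H g f)) \<and>
     (\<forall>f\<in>elements H. f \<noteq> (\<lambda>_. 0) \<longrightarrow> 0 < Re (ip H f f)) \<and>
     (\<forall>s. (\<forall>m. s m \<in> elements H) \<and>
          (\<forall>e>0. \<exists>N. \<forall>m\<ge>N. \<forall>k\<ge>N. hnorm H (\<lambda>z. s m z - s k z) < e) \<longrightarrow>
          (\<exists>f\<in>elements H. (\<lambda>m. hnorm H (\<lambda>z. s m z - f z)) \<longlonglongrightarrow> 0)) \<and>
     (\<forall>x\<in>points H. kernel_fun H x \<in> elements H \<and>
        (\<forall>f\<in>elements H. f x = ip H f (kernel_fun H x)))"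

text \<open>
  \<open>H\<close> is the restriction of the Drury-Arveson space to \<open>X\<close>. By the Moore-Aronszajn theorem
  this determines the function space and its inner product.
\<close>

definition drury_arveson_on :: "'d ell2 set \<Rightarrow> 'd ell2 fun_space \<Rightarrow> bool" where
  "drury_arveson_on X H \<longleftrightarrow> rkhs H \<and> points H = X \<and>
     (\<forall>z\<in>X. \<forall>w\<in>X. kernel H z w = 1 / (1 - cinner z w))"

definition op_norm ::
  "'a fun_space \<Rightarrow> 'b fun_space \<Rightarrow> (('a \<Rightarrow> complex) \<Rightarrow> ('b \<Rightarrow> complex)) \<Rightarrow> real" where
  "op_norm H K T = Sup {hnorm K (T f) |f. f \<in> elements H \<and> hnorm H f \<le> 1}"

definition rkhs_iso ::
  "'a fun_space \<Rightarrow> 'b fun_space \<Rightarrow> (('a \<Rightarrow> complex) \<Rightarrow> ('b \<Rightarrow> complex)) \<Rightarrow> bool" where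
  "rkhs_iso H K T \<longleftrightarrow>
     (\<forall>f\<in>elements H. \<forall>g\<in>elements H. T (\<lambda>z. f z + g z) = (\<lambda>z. T f z + T g z)) \<and>
     (\<forall>c. \<forall>f\<in>elements H. T (\<lambda>z. c * f z) = (\<lambda>z. c * T f z)) \<and>
     (\<exists>M. \<forall>f\<in>elements H. hnorm K (T f) \<le> M * hnorm H f) \<and>
     bij_betw T (elements H) (elements K) \<and>
     (\<exists>F l. bij_betw F (points H) (points K) \<and>
        (\<forall>x\<in>points H. l x \<noteq> (0 :: complex) \<and>
           T (kernel_fun H x) = (\<lambda>z. l x * kernel_fun K (F x) z)))"

text \<open>The value is infinite if there is no isomorphism.\<close>

definition delta_RK :: "'a fun_space \<Rightarrow> 'b fun_space \<Rightarrow> ereal" where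
  "delta_RK H K = (INF T\<in>{T. rkhs_iso H K T}.
     ereal (op_norm H K T * op_norm K H (inv_into (elements H) T)))"

end

theory Submission
  imports Defs
begin

text \<open>
  An RKHS isomorphism with \<open>\<parallel>T\<parallel> \<parallel>T\<inverse>\<parallel> = 1 + \<epsilon>\<close> changes the normalized Gram matrix of the kernel
  functions, up to a rescaling of these functions, by \<open>O(\<epsilon>)\<close>. Moving \<open>x\<^sub>0\<close> and \<open>y\<^sub>0\<close> to the origin
  by \<open>\<Psi>\<close>, the inner products of the moved points become \<open>1 - k\<^sub>i\<^sub>0 k\<^sub>0\<^sub>j / (k\<^sub>i\<^sub>j k\<^sub>0\<^sub>0)\<close>, in which
  the rescaling cancels. As the points of \<open>X\<close> have pseudohyperbolic distance at most \<open>r < 1\<close>, the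
  denominators are bounded below, so the Gram matrices of the moved points differ by \<open>O(\<epsilon>)\<close> as well,
  and a unitary map takes one configuration to within \<open>O(\<epsilon>\<^sup>1\<^sup>/\<^sup>2)\<close> of the other.
\<close>

section \<open>The complex inner product\<close>

text \<open>Nothing is known about the position of \<open>Y\<close>: its points may lie arbitrarily
  close to the unit sphere, yet the constant may involve only \<open>n\<close> and \<open>r\<close>.
  For this reason the Gram entries of both families are normalized by the kernel norms of
  \<open>X\<close>. Bounds from above and below are available for the entries of \<open>X\<close>,
  and those of \<open>Y\<close> inherit them by closeness.

  The unitary map has to act on the whole space, also in infinite dimension. Instead of extending an
  isometry between two spans, it is composed of rank-one perturbations of the identity, each
  carrying one unit vector to another, so surjectivity comes for free.

  For an isomorphism with norm product \<delta> close to 1 the resulting distance is of order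
  \<open>sqrt (\<delta> - 1)\<close>. If \<delta> is not close to 1, it suffices that
  pseudohyperbolic distances are less than 1. The exponent 1/4 accommodates both cases, because
  \<delta> < 2 puts \<delta> - 1 into the unit interval.\<close>

lemma scaleC_add_right: "c *\<^sub>C (x + y) = c *\<^sub>C x + c *\<^sub>C y"
  by (rule ell2_eqI) (simp add: plus_ell2.rep_eq scaleC.rep_eq algebra_simps)

lemma scaleC_diff_right: "c *\<^sub>C (x - y) = c *\<^sub>C x - c *\<^sub>C y"
  by (rule ell2_eqI) (simp add: minus_ell2.rep_eq scaleC.rep_eq algebra_simps)

lemma scaleC_add_left: "(c + d) *\<^sub>C x = c *\<^sub>C x + d *\<^sub>C x"
  by (rule ell2_eqI) (simp add: plus_ell2.rep_eq scaleC.rep_eq algebra_simps)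

lemma scaleC_diff_left: "(c - d) *\<^sub>C x = c *\<^sub>C x - d *\<^sub>C x"
  by (rule ell2_eqI) (simp add: minus_ell2.rep_eq scaleC.rep_eq algebra_simps)

lemma scaleC_scaleC [simp]: "c *\<^sub>C d *\<^sub>C x = (c * d) *\<^sub>C x"
  by (rule ell2_eqI) (simp add: scaleC.rep_eq)

lemma scaleC_one [simp]: "1 *\<^sub>C x = x"
  by (rule ell2_eqI) (simp add: scaleC.rep_eq)

lemma scaleC_zero_left [simp]: "0 *\<^sub>C x = 0"
  by (rule ell2_eqI) (simp add: scaleC.rep_eq zero_ell2.rep_eq)

lemma scaleC_zero_right [simp]: "c *\<^sub>C 0 = 0"
  by (rule ell2_eqI) (simp add: scaleC.rep_eq zero_ell2.rep_eq)

lemma scaleC_minus_left: "(- c) *\<^sub>C x = - (c *\<^sub>C x)"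
  by (rule ell2_eqI) (simp add: scaleC.rep_eq uminus_ell2.rep_eq)

lemma scaleC_minus_right: "c *\<^sub>C (- x) = - (c *\<^sub>C x)"
  by (rule ell2_eqI) (simp add: scaleC.rep_eq uminus_ell2.rep_eq)

lemma cinner_zero_left [simp]: "cinner 0 y = 0"
  using cinner_scaleC_left[of 0 0 y] by simp

lemma cinner_zero_right [simp]: "cinner x 0 = 0"
  using cinner_commute[of x 0] by simp

lemma cinner_minus_left: "cinner (- x) y = - cinner x y"
  using cinner_scaleC_left[of "-1" x y] by (simp add: scaleC_minus_left)

lemma cinner_diff_left: "cinner (x - y) z = cinner x z - cinner y z"
  using cinner_add_left[of x "- y" z] by (simp add: cinner_minus_left)

lemma cinner_add_right: "cinner x (y + z) = cinner x y + cinner x z"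
  by (subst (1 2 3) cinner_commute) (simp add: cinner_add_left)

lemma cinner_minus_right: "cinner x (- y) = - cinner x y"
  by (subst (1 2) cinner_commute) (simp add: cinner_minus_left)

lemma cinner_diff_right: "cinner x (y - z) = cinner x y - cinner x z"
  by (subst (1 2 3) cinner_commute) (simp add: cinner_diff_left)

lemma cinner_scaleC_right: "cinner x (c *\<^sub>C y) = cnj c * cinner x y"
  by (subst (1 2) cinner_commute) (simp add: cinner_scaleC_left)

lemmas cinner_simps = cinner_add_left cinner_add_right cinner_diff_left cinner_diff_right
  cinner_scaleC_left cinner_scaleC_right cinner_minus_left cinner_minus_right

lemma cnj_cinner [simp]: "cnj (cinner x y) = cinner y x"
  using cinner_commute[of y x] by simp

lemma cinner_norm: "cinner x x = complex_of_real ((norm x)\<^sup>2)"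
  using cinner_self[of x] by (simp add: power2_norm_eq_inner inner_ell2_def)

lemma norm_sq_cinner: "(norm x)\<^sup>2 = Re (cinner x x)"
  by (simp add: cinner_norm)

lemma norm_scaleC [simp]: "norm (c *\<^sub>C x) = cmod c * norm x"
proof (rule power2_eq_imp_eq)
  have "complex_of_real ((norm (c *\<^sub>C x))\<^sup>2) = (c * cnj c) * of_real ((norm x)\<^sup>2)"
    by (simp only: flip: cinner_norm) (simp add: cinner_simps)
  also have "\<dots> = complex_of_real ((cmod c * norm x)\<^sup>2)"
    by (simp add: power_mult_distrib flip: complex_norm_square)
  finally show "(norm (c *\<^sub>C x))\<^sup>2 = (cmod c * norm x)\<^sup>2"
    by (simp only: of_real_eq_iff)
qed auto

lemma cinner_Cauchy_Schwarz: "cmod (cinner x y) \<le> norm x * norm y"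
proof (cases "cinner x y = 0")
  case False
  define u where "u = cnj (cinner x y) / cmod (cinner x y)"
  have "cmod u = 1" using False by (simp add: u_def norm_divide del: cnj_cinner)
  have "u * cinner x y = of_real (cmod (cinner x y))"
    using False complex_norm_square[of "cinner x y"]
    by (simp del: cnj_cinner add: u_def field_simps power2_eq_square)
  then have "cmod (cinner x y) = (u *\<^sub>C x) \<bullet> y"
    by (simp add: inner_ell2_def cinner_simps)
  also have "\<dots> \<le> norm (u *\<^sub>C x) * norm y" by (rule norm_cauchy_schwarz)
  finally show ?thesis using \<open>cmod u = 1\<close> by simp
qed simp

section \<open>Vectors with nearly equal Gram matrices\<close>

text \<open>Surjectivity is part of the definition because an isometry of an infinite-dimensional
  space need not be onto, and the automorphisms built from \<open>U\<close> need its
  inverse.\<close>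

definition unitary :: "('d ell2 \<Rightarrow> 'd ell2) \<Rightarrow> bool" where
  "unitary U \<longleftrightarrow> (\<forall>x y. U (x + y) = U x + U y) \<and> (\<forall>c x. U (c *\<^sub>C x) = c *\<^sub>C U x) \<and>
     (\<forall>x y. cinner (U x) (U y) = cinner x y) \<and> surj U"

lemma unitary_id: "unitary (\<lambda>x. x)"
  by (simp add: unitary_def)

lemma unitary_compose:
  assumes "unitary U" "unitary V"
  shows "unitary (\<lambda>x. U (V x))"
  using assms comp_surj[of V U] by (auto simp: unitary_def comp_def)

lemma unitary_norm: "unitary U \<Longrightarrow> norm (U x) = norm x"
  by (rule power2_eq_imp_eq) (auto simp: unitary_def norm_sq_cinner)

lemma unitary_diff:
  assumes "unitary U"
  shows "U (x - y) = U x - U y"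
proof -
  have "U (x - y) + U y = U x"
    using assms by (metis unitary_def diff_add_cancel)
  then show ?thesis by (simp add: algebra_simps)
qed

text \<open>A rank-one perturbation of the identity along \<open>v = f - e\<close>, with the coefficient that makes it
  map \<open>f\<close> to \<open>e\<close>. For \<open>f = e\<close> the division by zero makes it the identity.\<close>

definition rot :: "'d ell2 \<Rightarrow> 'd ell2 \<Rightarrow> 'd ell2 \<Rightarrow> 'd ell2" where
  "rot f e z = z - (cinner z (f - e) / cinner f (f - e)) *\<^sub>C (f - e)"

text \<open>This supplies surjectivity of \<open>rot f e\<close>. Both maps move along the same
  line, spanned by \<open>v\<close>, with coefficients governed by \<open>c\<close> and
  \<open>cnj c\<close>; the correction terms cancel because
  \<open>cinner v v = c + cnj c\<close>.\<close>

lemma rot_rot: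
  assumes "norm e = 1" "norm f = 1"
  shows "rot f e (rot e f z) = z"
proof -
  define c v where "c = 1 - cinner e f" and "v = e - f"
  have ff: "cinner f f = 1" "cinner e e = 1" using assms by (auto simp: cinner_norm)
  have c: "cinner e (e - f) = c" "cinner f (f - e) = cnj c"
    by (simp_all add: cinner_simps ff c_def)
  have vv: "cinner v v = c + cnj c" by (simp add: v_def c_def cinner_simps ff)
  have "f - e = - v" by (simp add: v_def)
  define b where "b = cinner z v"
  have "rot e f z = z - (b / c) *\<^sub>C v"
    by (simp add: rot_def c b_def) (simp add: v_def)
  moreover have "rot f e u = u - (cinner u v / cnj c) *\<^sub>C v" for u
    unfolding rot_def c unfolding \<open>f - e = - v\<close>
    by (simp add: cinner_simps scaleC_minus_right scaleC_minus_left)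
  ultimately have "rot f e (rot e f z) = z - (b / c + (b - b / c * (c + cnj c)) / cnj c) *\<^sub>C v"
    by (simp add: cinner_simps b_def[symmetric] vv scaleC_add_left)
  also have "\<dots> = z"
  proof (cases "c = 0")
    case True
    then have "v = 0" using vv by (simp add: cinner_norm)
    then show ?thesis by simp
  next
    case False
    then show ?thesis by (simp add: field_simps)
  qed
  finally show ?thesis .
qed

text \<open>For unit vectors the squared length of \<open>v = f - e\<close> is
  \<open>c + cnj c\<close> with \<open>c = cinner f v\<close>. The change in the inner product
  therefore carries the factor \<open>(c + cnj c) / (c * cnj c) - 1 / c - 1 / cnj c\<close>, which
  is zero also when \<open>c\<close> is not real.\<close>

lemma unitary_rot:
  assumes "norm e = 1" "norm f = 1"
  shows "unitary (rot f e)"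
proof -
  have lin: "rot f e (x + y) = rot f e x + rot f e y" "rot f e (c *\<^sub>C x) = c *\<^sub>C rot f e x" for c x y
    unfolding rot_def cinner_add_left cinner_scaleC_left add_divide_distrib scaleC_add_left
      scaleC_diff_right by simp_all
  define c v where "c = cinner f (f - e)" and "v = f - e"
  have ff: "cinner f f = 1" "cinner e e = 1" using assms by (auto simp: cinner_norm)
  have vv: "cinner v v = c + cnj c" by (simp add: v_def c_def cinner_simps ff)
  have cv: "cinner f v = c" "cinner v f = cnj c" by (simp_all add: c_def v_def)
  have "cinner (rot f e x) (rot f e y) = cinner x y" for x y
  proof (cases "c = 0")
    case False
    have "cinner (rot f e x) (rot f e y) = cinner x y
       + cinner x v * cinner v y * ((c + cnj c) / (c * cnj c) - 1 / c - 1 / cnj c)"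
      using False unfolding rot_def v_def[symmetric] cv cinner_diff_left cinner_diff_right
        cinner_scaleC_left cinner_scaleC_right vv
      by (simp add: divide_simps) (simp add: algebra_simps)
    also have "(c + cnj c) / (c * cnj c) - 1 / c - 1 / cnj c = 0" using False by (simp add: field_simps)
    finally show ?thesis by simp
  qed (simp add: rot_def flip: c_def)
  moreover have "surj (rot f e)" using rot_rot[OF assms] by (metis surjI)
  ultimately show ?thesis using lin by (simp add: unitary_def)
qed

lemma rot_maps:
  assumes "norm e = 1" "norm f = 1"
  shows "rot f e f = e"
proof (cases "cinner f (f - e) = 0")
  case True
  moreover have "cinner e (f - e) = - cnj (cinner f (f - e))"
    using assms by (simp add: cinner_simps cinner_norm)
  ultimately have "cinner (f - e) (f - e) = 0"
    by (subst cinner_diff_left) simp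
  then show ?thesis by (simp add: cinner_norm rot_def)
qed (simp add: rot_def)

lemma rot_fixes:
  assumes "cinner w f = 0" "cinner w e = 0"
  shows "rot f e w = w"
  using assms by (simp add: rot_def cinner_simps)

text \<open>The error in a Schur complement entry after one elimination step. The bounds by
  \<open>s\<close> on the entries, which pivoting provides, cancel the division by \<open>s\<close>,
  so the error grows only by an absolute factor; 5/2 + 9/2 is rounded up to 8.\<close>

lemma schur_perturb:
  fixes a a' b b' :: complex and s t \<epsilon> :: real
  assumes "cmod (a - b) \<le> \<epsilon>" "cmod (a' - b') \<le> \<epsilon>" "\<bar>s - t\<bar> \<le> \<epsilon>"
    and "cmod a \<le> s" "cmod a' \<le> s" "0 < s" "2 * \<epsilon> \<le> s"
  shows "cmod (a * cnj a' / s - b * cnj b' / t) \<le> 8 * \<epsilon>"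
proof -
  have t: "s / 2 \<le> t" "t > 0" using assms by linarith+
  have e: "\<epsilon> \<ge> 0" using assms by linarith
  have b: "cmod b \<le> 3 / 2 * s" "cmod b' \<le> 3 / 2 * s"
    using norm_triangle_ineq2[of b a] norm_triangle_ineq2[of b' a'] assms
    by (auto simp: norm_minus_commute)
  have eq: "a * cnj a' / s - b * cnj b' / t =
      (a * cnj (a' - b') + (a - b) * cnj b') / s + b * cnj b' * of_real ((t - s) / (s * t))"
    using \<open>s > 0\<close> \<open>t > 0\<close> by (simp add: field_simps)
  have "cmod (a * cnj (a' - b')) \<le> s * \<epsilon>"
    unfolding norm_mult complex_mod_cnj using assms by (intro mult_mono) auto
  moreover have "cmod ((a - b) * cnj b') \<le> \<epsilon> * (3 / 2 * s)"
    unfolding norm_mult complex_mod_cnj using assms b e by (intro mult_mono) auto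
  ultimately have "cmod (a * cnj (a' - b') + (a - b) * cnj b') \<le> 5 / 2 * \<epsilon> * s"
    by (intro norm_triangle_le) (simp add: algebra_simps)
  then have 1: "cmod ((a * cnj (a' - b') + (a - b) * cnj b') / s) \<le> 5 / 2 * \<epsilon>"
    using \<open>s > 0\<close> by (simp only: norm_divide norm_of_real) (simp add: pos_divide_le_eq)
  have "cmod (b * cnj b') \<le> 3 / 2 * s * (3 / 2 * s)"
    unfolding norm_mult complex_mod_cnj using b \<open>s > 0\<close> by (intro mult_mono) auto
  moreover have "\<bar>(t - s) / (s * t)\<bar> \<le> \<epsilon> / (s * (s / 2))"
    unfolding abs_divide using t \<open>s > 0\<close> assms(3) e by (intro frac_le) (auto simp: abs_mult)
  ultimately have "cmod (b * cnj b' * of_real ((t - s) / (s * t))) \<le> (3 / 2 * s * (3 / 2 * s)) * (\<epsilon> / (s * (s/2)))"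
    unfolding norm_mult[of "b * cnj b'"] norm_of_real using \<open>s > 0\<close> by (intro mult_mono) auto
  also have "\<dots> = 9 / 2 * \<epsilon>" using \<open>s > 0\<close> by (simp add: field_simps)
  finally show ?thesis
    unfolding eq using 1 e by (intro norm_triangle_le) linarith
qed

text \<open>Controls the component along the split-off direction. Here a square root of the error is
  unavoidable, since one divides by \<open>sqrt s\<close> knowing only that \<open>s\<close> is at
  least \<open>2 * \<epsilon>\<close>. It enters the final distance, but not the Gram error handed
  to the next step.\<close>

lemma coeff_perturb:
  fixes a b :: complex and s t \<epsilon> :: real
  assumes "cmod (a - b) \<le> \<epsilon>" "\<bar>s - t\<bar> \<le> \<epsilon>" "cmod a \<le> s" "0 < s" "2 * \<epsilon> \<le> s"
  shows "cmod (a / sqrt s - b / sqrt t) \<le> 3 * sqrt \<epsilon>"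
proof -
  have t: "s / 2 \<le> t" "t > 0" using assms by linarith+
  have e: "\<epsilon> \<ge> 0" using assms by linarith
  have b: "cmod b \<le> 3 / 2 * s"
    using norm_triangle_ineq2[of b a] assms by (auto simp: norm_minus_commute)
  have st: "sqrt s > 0" "sqrt t > 0" "sqrt \<epsilon> \<le> sqrt s" "sqrt \<epsilon> \<le> sqrt t"
    using t assms by auto
  have sq: "sqrt s * sqrt s = s" "sqrt t * sqrt t = t" "sqrt \<epsilon> * sqrt \<epsilon> = \<epsilon>"
    using t assms e by auto
  have eq: "a / sqrt s - b / sqrt t = (a - b) / sqrt s + b * of_real ((sqrt t - sqrt s) / (sqrt s * sqrt t))"
    using st by (simp add: field_simps)
  have 1: "cmod ((a - b) / sqrt s) \<le> sqrt \<epsilon>"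
  proof -
    have "cmod (a - b) \<le> sqrt \<epsilon> * sqrt s"
      using assms mult_left_mono[OF st(3), of "sqrt \<epsilon>"] sq e by auto
    then show ?thesis using st by (simp add: norm_divide field_simps)
  qed
  have "\<bar>sqrt t - sqrt s\<bar> * sqrt s \<le> \<epsilon>"
  proof -
    have "\<bar>sqrt t - sqrt s\<bar> * sqrt s \<le> \<bar>sqrt t - sqrt s\<bar> * \<bar>sqrt t + sqrt s\<bar>"
      using st by (intro mult_left_mono) auto
    also have "\<dots> = \<bar>t - s\<bar>"
    proof -
      have "(sqrt t - sqrt s) * (sqrt t + sqrt s) = t - s"
        using t assms by (simp add: algebra_simps)
      then show ?thesis by (simp flip: abs_mult)
    qed
    finally show ?thesis using assms by auto
  qed
  then have "\<bar>sqrt t - sqrt s\<bar> \<le> \<epsilon> / sqrt s" using st by (simp add: pos_le_divide_eq)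
  then have "\<bar>(sqrt t - sqrt s) / (sqrt s * sqrt t)\<bar> \<le> (\<epsilon> / sqrt s) / (sqrt s * sqrt t)"
    unfolding abs_divide abs_of_pos[OF mult_pos_pos[OF st(1,2)]]
    using st by (intro divide_right_mono) auto
  then have "cmod (b * of_real ((sqrt t - sqrt s) / (sqrt s * sqrt t))) \<le>
     (3 / 2 * s) * ((\<epsilon> / sqrt s) / (sqrt s * sqrt t))"
    unfolding norm_mult norm_of_real using b assms by (intro mult_mono) auto
  also have "\<dots> = 3 / 2 * (s / (sqrt s * sqrt s)) * (\<epsilon> / sqrt t)"
    by (simp only: divide_inverse inverse_mult_distrib mult_ac)
  also have "\<dots> = 3 / 2 * (\<epsilon> / sqrt t)" unfolding sq using assms by simp
  also have "\<dots> \<le> 3 / 2 * sqrt \<epsilon>"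
    using st mult_left_mono[OF st(4), of "sqrt \<epsilon>"] sq e by (simp add: field_simps)
  finally show ?thesis
    unfolding eq using 1 real_sqrt_ge_zero[OF e] by (intro norm_triangle_le) linarith
qed

text \<open>Gram-Schmidt with pivoting: splitting off the longest vector keeps all divisions by its
  squared length s harmless, because it also bounds the other Gram entries, and the process stops
  as soon as s is comparable with the error. So no square root of the error is lost per step.\<close>

lemma unitary_of_gram_close_fixing:
  fixes x y :: "'i \<Rightarrow> 'd ell2"
  assumes "finite I" "card I = n"
    and "\<forall>i\<in>I. \<forall>j\<in>I. cmod (cinner (x i) (x j) - cinner (y i) (y j)) \<le> \<epsilon>"
    and "\<forall>i\<in>I. \<forall>e\<in>E. cinner e (x i) = 0 \<and> cinner e (y i) = 0"
  shows "\<exists>U. unitary U \<and> (\<forall>e\<in>E. U e = e) \<and>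
    (\<forall>i\<in>I. norm (x i - U (y i)) \<le> (4 * 3 ^ n - 2) * sqrt \<epsilon>)"
  using assms
proof (induction n arbitrary: I x y E \<epsilon>)
  case 0
  then show ?case using unitary_id by (intro exI[of _ "\<lambda>z. z"]) auto
next
  case (Suc n)
  note IH = Suc.IH and I = Suc.prems(1,2) and G = Suc.prems(3) and E = Suc.prems(4)
  \<comment> \<open>The constants solve the recursion \<open>C (n + 1) = 3 * C n + 4\<close> with
    \<open>C 0 = 2\<close>. The 3 is \<open>sqrt 9\<close>, as the Gram error grows to
    \<open>9 * \<epsilon>\<close> in one step; the 4 covers both the stopping case and the error of
    the split-off component.\<close>
  define C :: real where "C = 4 * 3 ^ n - 2"
  have C: "C \<ge> 2" using one_le_power[of "3 :: real" n] by (simp add: C_def)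
  have "\<exists>U. unitary U \<and> (\<forall>e\<in>E. U e = e) \<and> (\<forall>i\<in>I. norm (x i - U (y i)) \<le> (3 * C + 4) * sqrt \<epsilon>)"
  proof -
      have "I \<noteq> {}" using I by auto
    then have "Max ((\<lambda>i. norm (x i)) ` I) \<in> (\<lambda>i. norm (x i)) ` I" using I by simp
    then obtain p where "p \<in> I" and m: "norm (x p) = Max ((\<lambda>i. norm (x i)) ` I)" by auto
    have p: "p \<in> I" "\<And>i. i \<in> I \<Longrightarrow> norm (x i) \<le> norm (x p)"
      using \<open>p \<in> I\<close> I(1) by (auto simp: m)
    define s t where "s = (norm (x p))\<^sup>2" and "t = (norm (y p))\<^sup>2"
    have e: "\<epsilon> \<ge> 0" using G p norm_ge_zero order_trans by blast
    have Gd: "\<bar>(norm (x i))\<^sup>2 - (norm (y i))\<^sup>2\<bar> \<le> \<epsilon>" if "i \<in> I" for i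
      using G[rule_format, OF that that] unfolding cinner_norm of_real_diff[symmetric] norm_of_real .
    show ?thesis
    proof (cases "s \<le> 2 * \<epsilon>")
      \<comment> \<open>All vectors already have norm at most \<open>2 * sqrt \<epsilon>\<close>, so
        the identity serves as \<open>U\<close>.\<close>
      case True
      have "norm (x i - y i) \<le> (3 * C + 4) * sqrt \<epsilon>" if "i \<in> I" for i
      proof -
        have "(norm (x i))\<^sup>2 \<le> s" unfolding s_def using p that by (intro power_mono) auto
        then have "(norm (x i))\<^sup>2 \<le> (2 * sqrt \<epsilon>)\<^sup>2" "(norm (y i))\<^sup>2 \<le> (2 * sqrt \<epsilon>)\<^sup>2"
          using True Gd[OF that] e by (auto simp: power_mult_distrib)
        then have "norm (x i) \<le> 2 * sqrt \<epsilon>" "norm (y i) \<le> 2 * sqrt \<epsilon>"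
          using e by (auto intro: power2_le_imp_le)
        then have "norm (x i - y i) \<le> 4 * sqrt \<epsilon>"
          using norm_triangle_ineq4[of "x i" "y i"] by linarith
        also have "\<dots> \<le> (3 * C + 4) * sqrt \<epsilon>" using C e by (intro mult_right_mono) auto
        finally show ?thesis .
      qed
      then show ?thesis using unitary_id by blast
    next
      case False
      then have s: "s > 0" "2 * \<epsilon> \<le> s" and st: "\<bar>s - t\<bar> \<le> \<epsilon>"
        using e Gd[OF p(1)] by (auto simp: s_def t_def)
      then have t: "t > 0" by linarith
      define a b where "a i = cinner (x i) (x p)" and "b i = cinner (y i) (y p)" for i
      have ab: "cmod (a i - b i) \<le> \<epsilon>" if "i \<in> I" for i
        using G that p by (simp add: a_def b_def)
      have a: "cmod (a i) \<le> s" if "i \<in> I" for i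
        using cinner_Cauchy_Schwarz[of "x i" "x p"] p(2)[OF that]
          mult_right_mono[OF p(2)[OF that], of "norm (x p)"]
        by (simp add: a_def s_def power2_eq_square)
      define e f where "e = (1 / sqrt s) *\<^sub>C x p" and "f = (1 / sqrt t) *\<^sub>C y p"
      have nef: "norm e = 1" "norm f = 1"
        using s t by (simp_all add: e_def f_def norm_divide) (simp_all add: s_def t_def)
      define V where "V = rot f e"
      have V: "unitary V" "V f = e" using unitary_rot rot_maps nef by (auto simp: V_def)
      have VE: "V w = w" if "w \<in> E" for w
        unfolding V_def using E p(1) that by (intro rot_fixes) (auto simp: e_def f_def cinner_simps)
      define \<alpha> \<beta> where "\<alpha> i = a i / sqrt s" and "\<beta> i = b i / sqrt t" for i
      have xe: "cinner (x i) e = \<alpha> i" for i by (simp add: e_def cinner_simps a_def \<alpha>_def)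
      have ye: "cinner (V (y i)) e = \<beta> i" for i
      proof -
        have "cinner (V (y i)) (V f) = cinner (y i) f" using V(1) by (simp add: unitary_def)
        then show ?thesis by (simp add: V(2)) (simp add: f_def cinner_simps b_def \<beta>_def)
      qed
      have ee: "cinner e e = 1" using nef by (simp add: cinner_norm)
      have ex: "cinner e (x i) = cnj (\<alpha> i)" and ey: "cinner e (V (y i)) = cnj (\<beta> i)" for i
        unfolding xe[symmetric] ye[symmetric] by simp_all
      define x' y' where "x' i = x i - \<alpha> i *\<^sub>C e" and "y' i = V (y i) - \<beta> i *\<^sub>C e" for i
      have "cmod (cinner (x' i) (x' j) - cinner (y' i) (y' j)) \<le> 9 * \<epsilon>" if ij: "i \<in> I" "j \<in> I" for i j
      proof -
        have "\<alpha> i * cnj (\<alpha> j) = a i * cnj (a j) / s" "\<beta> i * cnj (\<beta> j) = b i * cnj (b j) / t"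
          using s t by (simp_all add: \<alpha>_def \<beta>_def flip: of_real_mult)
        moreover have "cinner (x' i) (x' j) = cinner (x i) (x j) - \<alpha> i * cnj (\<alpha> j)"
          by (simp add: x'_def cinner_simps xe ex ee)
        moreover have "cinner (y' i) (y' j) = cinner (y i) (y j) - \<beta> i * cnj (\<beta> j)"
          using V(1) by (simp add: y'_def cinner_simps ye ey ee unitary_def)
        ultimately have "cinner (x' i) (x' j) - cinner (y' i) (y' j) =
            (cinner (x i) (x j) - cinner (y i) (y j)) - (a i * cnj (a j) / s - b i * cnj (b j) / t)"
          by simp
        also have "cmod \<dots> \<le> \<epsilon> + 8 * \<epsilon>"
          by (rule order_trans[OF norm_triangle_ineq4], rule add_mono)
             (use G ij in \<open>auto intro!: schur_perturb ab a st s\<close>)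
        finally show ?thesis by simp
      qed
      \<comment> \<open>Adding \<open>e\<close> to the vectors orthogonal to the residuals makes the
        inductive \<open>U\<close> fix \<open>e\<close>. The removed component
        \<open>\<beta> i *\<^sub>C e\<close> then passes through \<open>U\<close> unchanged and can
        be put back.\<close>
      moreover have "cinner w (x' i) = 0 \<and> cinner w (y' i) = 0" if "i \<in> I" "w \<in> insert e E" for i w
      proof (cases "w = e")
        case True
        then show ?thesis by (simp add: x'_def y'_def cinner_simps ex ey ee)
      next
        case False
        then have w: "w \<in> E" using that by simp
        have "cinner w (V (y i)) = cinner (V w) (V (y i))" using VE[OF w] by simp
        also have "\<dots> = cinner w (y i)" using V by (simp add: unitary_def)
        finally have "cinner w (V (y i)) = 0" using E that w by simp
        then show ?thesis using E that w p(1) by (simp add: x'_def y'_def cinner_simps e_def)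
      qed
      ultimately obtain U where U: "unitary U" "\<forall>w\<in>insert e E. U w = w"
        "\<forall>i\<in>I - {p}. norm (x' i - U (y' i)) \<le> C * sqrt (9 * \<epsilon>)"
        using IH[of "I - {p}" x' y' "9 * \<epsilon>" "insert e E"] I p(1) unfolding C_def by fastforce
      have xyp: "x' p = 0" "y' p = 0"
      proof -
        have "a p = s" "b p = t" by (simp_all add: a_def b_def s_def t_def cinner_norm)
        then have "\<alpha> p = sqrt s" "\<beta> p = sqrt t"
          using s t by (simp_all add: \<alpha>_def \<beta>_def real_div_sqrt flip: of_real_divide)
        moreover have "x p = sqrt s *\<^sub>C e" "y p = sqrt t *\<^sub>C f"
          using s t by (simp_all add: e_def f_def)
        moreover have "V (sqrt t *\<^sub>C f) = sqrt t *\<^sub>C e" using V by (simp add: unitary_def)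
        ultimately show "x' p = 0" "y' p = 0" by (simp_all add: x'_def y'_def)
      qed
      have "norm (x i - U (V (y i))) \<le> (3 * C + 4) * sqrt \<epsilon>" if "i \<in> I" for i
      proof -
        have "norm (x' i - U (y' i)) \<le> 3 * C * sqrt \<epsilon>"
        proof (cases "i = p")
          case True
          then show ?thesis using xyp C e unitary_norm[OF U(1), of 0] by simp
        next
          case False
          then show ?thesis using U(3) that by (simp add: real_sqrt_mult mult_ac)
        qed
        moreover have "norm ((\<alpha> i - \<beta> i) *\<^sub>C e) \<le> 3 * sqrt \<epsilon>"
          using coeff_perturb[OF ab st a s] that nef by (simp add: \<alpha>_def \<beta>_def)
        ultimately have "norm ((x' i - U (y' i)) + (\<alpha> i - \<beta> i) *\<^sub>C e) \<le> 3 * C * sqrt \<epsilon> + 3 * sqrt \<epsilon>"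
          by (rule norm_triangle_mono)
        moreover have "U (y' i) = U (V (y i)) - \<beta> i *\<^sub>C e"
          using U by (simp add: y'_def unitary_diff) (simp add: unitary_def)
        then have "(x' i - U (y' i)) + (\<alpha> i - \<beta> i) *\<^sub>C e = x i - U (V (y i))"
          by (simp add: x'_def scaleC_diff_left)
        moreover have "3 * C * sqrt \<epsilon> + 3 * sqrt \<epsilon> \<le> (3 * C + 4) * sqrt \<epsilon>"
          using e by (simp add: algebra_simps)
        ultimately show ?thesis by (simp only:)
      qed
      moreover have "\<forall>w\<in>E. U (V w) = w" using VE U(2) by simp
      ultimately show ?thesis using unitary_compose[OF U(1) V(1)] by blast
    qed
  qed
  then show ?case by (simp add: C_def algebra_simps)
qed

lemma unitary_of_gram_close:
  fixes x y :: "nat \<Rightarrow> 'd ell2"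
  assumes "\<And>i j. i < n \<Longrightarrow> j < n \<Longrightarrow> cmod (cinner (x i) (x j) - cinner (y i) (y j)) \<le> \<epsilon>"
  obtains U where "unitary U" "\<And>i. i < n \<Longrightarrow> norm (x i - U (y i)) \<le> (4 * 3 ^ n - 2) * sqrt \<epsilon>"
  using unitary_of_gram_close_fixing[of "{..<n}" n x y \<epsilon> "{}"] assms that by auto

section \<open>The automorphisms of the ball\<close>

lemma norm_less_1_cinner_neq_1:
  assumes "norm z < 1" "norm w < 1"
  shows "1 - cinner z w \<noteq> 0"
proof
  assume "1 - cinner z w = 0"
  then have "cmod (cinner z w) = 1" by simp
  moreover have "norm z * norm w < 1"
    using assms by (meson le_less_trans mult_left_le norm_ge_zero less_imp_le)
  ultimately show False using cinner_Cauchy_Schwarz[of z w] by simp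
qed

text \<open>Since \<open>\<parallel>w\<parallel>\<^sup>2 = (1 - s) (1 + s)\<close> for \<open>s = sqrt (1 - \<parallel>w\<parallel>\<^sup>2)\<close>, the division by \<open>\<parallel>w\<parallel>\<^sup>2\<close> in
  the projection can be cancelled, so that the case \<open>w = 0\<close> is not special.\<close>

lemma Psi_alt:
  assumes "norm w < 1"
  defines "s \<equiv> sqrt (1 - (norm w)\<^sup>2)"
  shows "Psi w z = (1 / (1 - cinner z w)) *\<^sub>C ((1 - cinner z w / (1 + s)) *\<^sub>C w - s *\<^sub>C z)"
proof -
  have "(norm w)\<^sup>2 < 1" using assms by (simp add: power_less_one_iff abs_square_less_1)
  then have s: "s > 0" "(norm w)\<^sup>2 = (1 - s) * (1 + s)"
    by (simp_all add: s_def algebra_simps)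
  have "proj w z - s *\<^sub>C proj w z = (cinner z w / (1 + s)) *\<^sub>C w"
  proof (cases "w = 0")
    case False
    then have "1 - s \<noteq> 0" "1 + s \<noteq> 0" using s by auto
    have "complex_of_real ((1 - s) / ((1 - s) * (1 + s))) = of_real (1 / (1 + s))"
      using \<open>1 - s \<noteq> 0\<close> by simp
    then have "(1 - complex_of_real s) / cinner w w = 1 / (1 + s)"
      unfolding cinner_norm s(2) of_real_divide by simp
    moreover have "(1 - s) * (cinner z w / cinner w w) = cinner z w * ((1 - complex_of_real s) / cinner w w)"
      by (simp add: divide_inverse mult_ac)
    ultimately have "(1 - s) * (cinner z w / cinner w w) = cinner z w / (1 + s)"
      by (simp only:) simp
    moreover have "proj w z - s *\<^sub>C proj w z = ((1 - s) * (cinner z w / cinner w w)) *\<^sub>C w"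
      unfolding proj_def of_real_diff left_diff_distrib scaleC_diff_left by simp
    ultimately show ?thesis by simp
  qed (simp add: proj_def)
  moreover have "w - proj w z - s *\<^sub>C (z - proj w z) = w - (proj w z - s *\<^sub>C proj w z) - s *\<^sub>C z"
    by (simp add: scaleC_diff_right)
  ultimately have "w - proj w z - s *\<^sub>C (z - proj w z) = (1 - cinner z w / (1 + s)) *\<^sub>C w - s *\<^sub>C z"
    by (simp only:) (simp add: scaleC_diff_left)
  then show ?thesis
    unfolding Psi_def scaleR_ell2_def s_def[symmetric] by simp
qed

text \<open>The source of the norm formula for \<open>Psi\<close>, of the invariance of
  \<open>rho_ph\<close> and of the kernel formula for moved points. With \<open>m\<close> standing
  for \<open>1 / (1 + s)\<close>, what remains is polynomial algebra modulo
  \<open>m * (1 + \<sigma>) = 1\<close>.\<close>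

lemma one_minus_cinner_Psi:
  assumes "norm a < 1" "norm z < 1" "norm w < 1"
  shows "1 - cinner (Psi a z) (Psi a w) =
    (1 - cinner a a) * (1 - cinner z w) / ((1 - cinner z a) * (1 - cinner a w))"
proof -
  define s where "s = sqrt (1 - (norm a)\<^sup>2)"
  have "(norm a)\<^sup>2 < 1" using assms by (simp add: power_less_one_iff abs_square_less_1)
  then have s: "s > 0" "(norm a)\<^sup>2 = 1 - s\<^sup>2"
    by (simp_all add: s_def)
  define m \<sigma> where "m = complex_of_real (1 / (1 + s))" and "\<sigma> = complex_of_real s"
  have "m * (1 + \<sigma>) = of_real (1 / (1 + s) * (1 + s))"
    by (simp only: m_def \<sigma>_def of_real_mult of_real_add of_real_1)
  then have m: "m * (1 + \<sigma>) = 1" "cnj m = m" "cnj \<sigma> = \<sigma>"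
    using s by (simp_all add: m_def \<sigma>_def)
  have aa: "cinner a a = 1 - \<sigma>\<^sup>2" by (simp add: cinner_norm s \<sigma>_def)
  have P: "Psi a u = (1 / (1 - cinner u a)) *\<^sub>C ((1 - cinner u a * m) *\<^sub>C a - \<sigma> *\<^sub>C u)" for u
    using Psi_alt[OF assms(1), of u] by (simp add: m_def s_def \<sigma>_def)
  define \<beta> \<gamma> \<zeta> where "\<beta> = cinner z a" and "\<gamma> = cinner a w" and "\<zeta> = cinner z w"
  have wa: "cinner w a = cnj \<gamma>" by (simp add: \<gamma>_def)
  have nz: "1 - \<beta> \<noteq> 0" "1 - \<gamma> \<noteq> 0"
    using norm_less_1_cinner_neq_1 assms by (auto simp: \<beta>_def \<gamma>_def)
  \<comment> \<open>The scalars are kept as free variables so that the identity is polynomial. The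
    conjugates on \<open>q\<close> and \<open>v\<close> undo the conjugation in the second
    argument.\<close>
  have "cinner (p *\<^sub>C (u *\<^sub>C a - \<sigma> *\<^sub>C z)) (cnj q *\<^sub>C (cnj v *\<^sub>C a - \<sigma> *\<^sub>C w)) =
      p * q * (u * v * (1 - \<sigma>\<^sup>2) - u * \<sigma> * \<gamma> - \<sigma> * \<beta> * v + \<sigma>\<^sup>2 * \<zeta>)" for p q u v
    unfolding cinner_simps aa m(3) \<beta>_def[symmetric] \<gamma>_def[symmetric] \<zeta>_def[symmetric] complex_cnj_cnj
    by algebra
  from this[of "1 / (1 - \<beta>)" "1 - \<beta> * m" "1 / (1 - \<gamma>)" "1 - \<gamma> * m"]
  have "cinner (Psi a z) (Psi a w) = (1 / (1 - \<beta>)) * (1 / (1 - \<gamma>)) *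
      ((1 - \<beta> * m) * (1 - \<gamma> * m) * (1 - \<sigma>\<^sup>2) - (1 - \<beta> * m) * \<sigma> * \<gamma> - \<sigma> * \<beta> * (1 - \<gamma> * m) + \<sigma>\<^sup>2 * \<zeta>)"
    unfolding P[of z] P[of w] wa \<beta>_def[symmetric] by (simp add: m(2))
  also have "(1 - \<beta> * m) * (1 - \<gamma> * m) * (1 - \<sigma>\<^sup>2) - (1 - \<beta> * m) * \<sigma> * \<gamma> - \<sigma> * \<beta> * (1 - \<gamma> * m) + \<sigma>\<^sup>2 * \<zeta>
     = (1 - \<beta>) * (1 - \<gamma>) - \<sigma>\<^sup>2 * (1 - \<zeta>)"
    using m(1) by algebra
  also have "(1 / (1 - \<beta>)) * (1 / (1 - \<gamma>)) * ((1 - \<beta>) * (1 - \<gamma>) - \<sigma>\<^sup>2 * (1 - \<zeta>)) =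
      1 - \<sigma>\<^sup>2 * (1 - \<zeta>) / ((1 - \<beta>) * (1 - \<gamma>))"
    using nz by (simp add: diff_divide_distrib)
  finally show ?thesis unfolding aa \<beta>_def[symmetric] \<gamma>_def[symmetric] \<zeta>_def[symmetric] by simp
qed

lemma one_minus_norm_Psi:
  assumes "norm a < 1" "norm z < 1"
  shows "1 - (norm (Psi a z))\<^sup>2 = (1 - (norm a)\<^sup>2) * (1 - (norm z)\<^sup>2) / (cmod (1 - cinner z a))\<^sup>2"
proof -
  have "complex_of_real (1 - (norm (Psi a z))\<^sup>2) =
      of_real ((1 - (norm a)\<^sup>2) * (1 - (norm z)\<^sup>2)) / ((1 - cinner z a) * cnj (1 - cinner z a))"
    using one_minus_cinner_Psi[OF assms(1,2,2)] by (simp add: cinner_norm)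
  also have "\<dots> = complex_of_real ((1 - (norm a)\<^sup>2) * (1 - (norm z)\<^sup>2) / (cmod (1 - cinner z a))\<^sup>2)"
    by (simp only: of_real_divide complex_norm_square)
  finally show ?thesis by (simp only: of_real_eq_iff)
qed

lemma norm_Psi_less_1:
  assumes "norm a < 1" "norm z < 1"
  shows "norm (Psi a z) < 1"
proof -
  have "1 - (norm (Psi a z))\<^sup>2 > 0"
    unfolding one_minus_norm_Psi[OF assms] using norm_less_1_cinner_neq_1[OF assms(2,1)] assms
    by (intro divide_pos_pos mult_pos_pos) (auto simp: abs_square_less_1)
  then show ?thesis by (simp add: abs_square_less_1)
qed

text \<open>The second application depends on \<gamma>, the inner product of \<open>Psi a z\<close>
  with \<open>a\<close>, and \<open>(1 - \<gamma>) * (1 - \<beta>) = \<sigma>\<^sup>2\<close>. This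
  relation makes the coefficient of \<open>a\<close> vanish and that of \<open>z\<close> equal to
  \<open>1 - \<gamma>\<close>, which the denominator cancels.\<close>

lemma Psi_Psi:
  assumes "norm a < 1" "norm z < 1"
  shows "Psi a (Psi a z) = z"
proof -
  define s where "s = sqrt (1 - (norm a)\<^sup>2)"
  have "(norm a)\<^sup>2 < 1" using assms by (simp add: power_less_one_iff abs_square_less_1)
  then have s: "s > 0" "(norm a)\<^sup>2 = 1 - s\<^sup>2"
    by (simp_all add: s_def)
  define m \<sigma> where "m = complex_of_real (1 / (1 + s))" and "\<sigma> = complex_of_real s"
  have "m * (1 + \<sigma>) = of_real (1 / (1 + s) * (1 + s))"
    by (simp only: m_def \<sigma>_def of_real_mult of_real_add of_real_1)
  then have m: "m * (1 + \<sigma>) = 1" "cnj m = m" "cnj \<sigma> = \<sigma>"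
    using s by (simp_all add: m_def \<sigma>_def)
  have aa: "cinner a a = 1 - \<sigma>\<^sup>2" by (simp add: cinner_norm s \<sigma>_def)
  have P: "Psi a u = (1 / (1 - cinner u a)) *\<^sub>C ((1 - cinner u a * m) *\<^sub>C a - \<sigma> *\<^sub>C u)" for u
    using Psi_alt[OF assms(1), of u] by (simp add: m_def s_def \<sigma>_def)
  define \<beta> \<gamma> where "\<beta> = cinner z a" and "\<gamma> = cinner (Psi a z) a"
  have nz: "1 - \<beta> \<noteq> 0" using norm_less_1_cinner_neq_1 assms by (auto simp: \<beta>_def)
  have "\<gamma> * (1 - \<beta>) = (1 - \<beta> * m) * (1 - \<sigma>\<^sup>2) - \<sigma> * \<beta>"
    unfolding \<gamma>_def P[of z] cinner_simps aa \<beta>_def[symmetric] using nz by simp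
  then have 1: "(1 - \<gamma>) * (1 - \<beta>) = \<sigma>\<^sup>2" using m(1) by algebra
  then have nz': "1 - \<gamma> \<noteq> 0" using s by (auto simp: \<sigma>_def)
  define p where "p = 1 / (1 - \<beta>)"
  have p: "p * (1 - \<beta>) = 1" using nz by (simp add: p_def)
  have "(1 - \<gamma> * m) *\<^sub>C a - \<sigma> *\<^sub>C Psi a z =
      ((1 - \<gamma> * m) - \<sigma> * p * (1 - \<beta> * m)) *\<^sub>C a + (\<sigma>\<^sup>2 * p) *\<^sub>C z"
    unfolding P[of z] \<beta>_def[symmetric] p_def[symmetric]
    by (simp add: scaleC_diff_left scaleC_diff_right scaleC_add_left scaleC_add_right
        algebra_simps power2_eq_square)
  moreover have "(1 - \<gamma> * m) - \<sigma> * p * (1 - \<beta> * m) = 0"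
  proof -
    have "1 - m = m * \<sigma>" using m(1) by (simp add: algebra_simps)
    have "(1 - \<beta>) * (1 - \<gamma> * m) = (1 - \<beta>) * (1 - m) + m * ((1 - \<gamma>) * (1 - \<beta>))"
      by (simp add: algebra_simps)
    also have "\<dots> = (1 - \<beta>) * (m * \<sigma>) + m * \<sigma>\<^sup>2"
      unfolding 1 \<open>1 - m = m * \<sigma>\<close> ..
    also have "\<dots> = \<sigma> * (m * (1 + \<sigma>) - \<beta> * m)"
      by (simp add: algebra_simps power2_eq_square)
    finally have "(1 - \<beta>) * (1 - \<gamma> * m) = \<sigma> * (m * (1 + \<sigma>) - \<beta> * m)" .
    then have "p * (1 - \<beta>) * (1 - \<gamma> * m) = \<sigma> * p * (1 - \<beta> * m)"
      unfolding m(1) by simp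
    then show ?thesis unfolding p by simp
  qed
  moreover have "\<sigma>\<^sup>2 * p = 1 - \<gamma>"
    using nz unfolding 1[symmetric] p_def by simp
  ultimately have "(1 - \<gamma> * m) *\<^sub>C a - \<sigma> *\<^sub>C Psi a z = (1 - \<gamma>) *\<^sub>C z" by simp
  then show ?thesis
    unfolding P[of "Psi a z"] \<gamma>_def[symmetric] using nz' by simp
qed

section \<open>The pseudohyperbolic metric: invariance and comparison with the norm\<close>

lemma rho_ph_sq:
  assumes "norm z < 1" "norm w < 1"
  shows "(rho_ph z w)\<^sup>2 = 1 - (1 - (norm z)\<^sup>2) * (1 - (norm w)\<^sup>2) / (cmod (1 - cinner z w))\<^sup>2"
  using one_minus_norm_Psi[OF assms(2,1)] by (simp add: rho_ph_def algebra_simps)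

lemma rho_ph_nonneg: "rho_ph z w \<ge> 0"
  by (simp add: rho_ph_def)

lemma rho_ph_less_1: "norm z < 1 \<Longrightarrow> norm w < 1 \<Longrightarrow> rho_ph z w < 1"
  by (simp add: rho_ph_def norm_Psi_less_1)

text \<open>By \<open>rho_ph_sq\<close> the distance is determined by one quotient, and the factors
  that \<open>Psi a\<close> contributes to its numerator and denominator cancel.\<close>

lemma rho_ph_Psi:
  assumes "norm a < 1" "norm z < 1" "norm w < 1"
  shows "rho_ph (Psi a z) (Psi a w) = rho_ph z w"
proof (rule power2_eq_imp_eq)
  have nz: "1 - cinner z a \<noteq> 0" "1 - cinner a w \<noteq> 0" "1 - cinner a a \<noteq> 0"  "1 - cinner w a \<noteq> 0"
    using norm_less_1_cinner_neq_1 assms by auto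
  have aa: "cmod (1 - cinner a a) = 1 - (norm a)\<^sup>2"
  proof -
    have "1 - cinner a a = of_real (1 - (norm a)\<^sup>2)" by (simp add: cinner_norm)
    then show ?thesis using assms by (simp only: norm_of_real) (simp add: abs_square_le_1)
  qed
  then have aa0: "1 - (norm a)\<^sup>2 \<noteq> 0" using nz by auto
  have aw: "cmod (1 - cinner a w) = cmod (1 - cinner w a)"
    by (metis cnj_cinner complex_cnj_diff complex_cnj_one complex_mod_cnj)
  have "(1 - (norm (Psi a z))\<^sup>2) * (1 - (norm (Psi a w))\<^sup>2) / (cmod (1 - cinner (Psi a z) (Psi a w)))\<^sup>2
      = (1 - (norm z)\<^sup>2) * (1 - (norm w)\<^sup>2) / (cmod (1 - cinner z w))\<^sup>2"
    unfolding one_minus_norm_Psi[OF assms(1,2)] one_minus_norm_Psi[OF assms(1,3)]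
      one_minus_cinner_Psi[OF assms] norm_divide norm_mult aa aw
    using aa0 nz by (simp add: power_divide power_mult_distrib) (simp add: power2_eq_square)
  then show "(rho_ph (Psi a z) (Psi a w))\<^sup>2 = (rho_ph z w)\<^sup>2"
    by (simp add: rho_ph_sq norm_Psi_less_1 assms)
qed (auto simp: rho_ph_nonneg)

text \<open>One point away from the sphere is enough, because \<open>cmod (cinner z w)\<close> is at
  most the norm of \<open>z\<close>. The bound is applied with a moved point of \<open>X\<close> as
  \<open>z\<close>, whose norm is its distance to the base point and hence at most
  \<open>r\<close>.\<close>

lemma rho_ph_le:
  assumes "norm z \<le> r" "r < 1" "norm w < 1"
  shows "rho_ph z w \<le> norm (z - w) / (1 - r)"
proof (rule power2_le_imp_le)
  have r: "norm z < 1" using assms by simp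
  define c where "c = cmod (1 - cinner z w)"
  have "cmod (cinner z w) \<le> r"
    using cinner_Cauchy_Schwarz[of z w] mult_left_le[OF less_imp_le[OF assms(3)], of "norm z"] assms(1) by simp
  then have c: "1 - r \<le> c" "c > 0" using norm_triangle_ineq2[of 1 "cinner z w"] assms by (auto simp: c_def)
  have "(norm (z - w))\<^sup>2 = (norm z)\<^sup>2 + (norm w)\<^sup>2 - 2 * Re (cinner z w)"
    by (simp add: power2_norm_eq_inner inner_diff inner_commute[of w z]) (simp add: inner_ell2_def)
  moreover have "c\<^sup>2 = 1 - 2 * Re (cinner z w) + (cmod (cinner z w))\<^sup>2"
    unfolding c_def cmod_power2 by (simp add: power2_eq_square algebra_simps)
  moreover have "(cmod (cinner z w))\<^sup>2 \<le> (norm z)\<^sup>2 * (norm w)\<^sup>2"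
    unfolding power_mult_distrib[symmetric] by (intro power_mono cinner_Cauchy_Schwarz) auto
  ultimately have "c\<^sup>2 - (1 - (norm z)\<^sup>2) * (1 - (norm w)\<^sup>2) \<le> (norm (z - w))\<^sup>2"
    by (simp add: algebra_simps)
  then have "(c\<^sup>2 - (1 - (norm z)\<^sup>2) * (1 - (norm w)\<^sup>2)) / c\<^sup>2 \<le> (norm (z - w))\<^sup>2 / c\<^sup>2"
    by (intro divide_right_mono) auto
  then have "(rho_ph z w)\<^sup>2 \<le> (norm (z - w))\<^sup>2 / c\<^sup>2"
    unfolding rho_ph_sq[OF r assms(3)] c_def[symmetric] using c by (simp add: diff_divide_distrib)
  also have "\<dots> \<le> (norm (z - w))\<^sup>2 / (1 - r)\<^sup>2"
    using c assms(2) by (intro divide_left_mono power_mono mult_pos_pos) auto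
  finally show "(rho_ph z w)\<^sup>2 \<le> (norm (z - w) / (1 - r))\<^sup>2" by (simp add: power_divide)
qed (use assms in auto)

section \<open>Holomorphy and automorphisms of the ball\<close>

lemma bounded_linear_cinner_left: "bounded_linear (\<lambda>z. cinner z w)"
  by (rule bounded_linear_intro[where K = "norm w"])
     (auto simp: cinner_simps scaleR_ell2_def scaleR_conv_of_real cinner_Cauchy_Schwarz)

lemma bounded_bilinear_scaleC: "bounded_bilinear scaleC"
  by (rule bounded_bilinear.intro)
     (auto simp: scaleC_add_left scaleC_add_right scaleR_ell2_def scaleR_conv_of_real mult.commute
      intro: exI[of _ 1])

text \<open>\<open>Psi a\<close> is built from scalar functions of \<open>cinner z a\<close> and
  from \<open>z\<close> itself, so one-variable derivatives and the product rule suffice. The values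
  of \<open>g'\<close> and \<open>h'\<close> are irrelevant: \<open>v\<close> enters each term of
  the derivative complex linearly.\<close>

lemma holomorphic_ell2_Psi:
  fixes a :: "'d ell2"
  assumes "norm a < 1"
  shows "holomorphic_ell2 (Psi a) (ball 0 1)"
  unfolding holomorphic_ell2_def
proof
  fix z :: "'d ell2" assume "z \<in> ball 0 1"
  then have "1 - cinner z a \<noteq> 0" using norm_less_1_cinner_neq_1 assms by auto
  define s where "s = complex_of_real (sqrt (1 - (norm a)\<^sup>2))"
  define g where "g u = 1 / (1 - u)" for u :: complex
  define h where "h u = 1 - u / (1 + s)" for u :: complex
  have Psi: "Psi a = (\<lambda>z. g (cinner z a) *\<^sub>C (h (cinner z a) *\<^sub>C a - s *\<^sub>C z))"
    using Psi_alt[OF assms] by (auto simp: g_def h_def s_def)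
  obtain g' where "(g has_field_derivative g') (at (cinner z a))"
  proof
    show "(g has_field_derivative 1 / (1 - cinner z a)\<^sup>2) (at (cinner z a))"
      unfolding g_def using \<open>1 - cinner z a \<noteq> 0\<close>
      by (auto intro!: derivative_eq_intros simp: power2_eq_square)
  qed
  then have g: "((\<lambda>z. g (cinner z a)) has_derivative (\<lambda>v. g' * cinner v a)) (at z)"
    unfolding has_field_derivative_def
    by (rule has_derivative_compose[OF bounded_linear_imp_has_derivative[OF bounded_linear_cinner_left]])
  obtain h' where "(h has_field_derivative h') (at (cinner z a))"
  proof
    show "(h has_field_derivative - inverse (1 + s)) (at (cinner z a))"
      unfolding h_def divide_inverse by (auto intro!: derivative_eq_intros)
  qed
  then have h: "((\<lambda>z. h (cinner z a)) has_derivative (\<lambda>v. h' * cinner v a)) (at z)"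
    unfolding has_field_derivative_def
    by (rule has_derivative_compose[OF bounded_linear_imp_has_derivative[OF bounded_linear_cinner_left]])
  have ha: "((\<lambda>z. h (cinner z a) *\<^sub>C a) has_derivative (\<lambda>v. (h' * cinner v a) *\<^sub>C a)) (at z)"
    using bounded_bilinear.FDERIV[OF bounded_bilinear_scaleC h has_derivative_const[of a]] by simp
  have sz: "((\<lambda>z. s *\<^sub>C z) has_derivative (\<lambda>v. s *\<^sub>C v)) (at z)"
    by (intro bounded_linear_imp_has_derivative bounded_bilinear.bounded_linear_right[OF bounded_bilinear_scaleC])
  have "(Psi a has_derivative (\<lambda>v. g (cinner z a) *\<^sub>C ((h' * cinner v a) *\<^sub>C a - s *\<^sub>C v) +
      (g' * cinner v a) *\<^sub>C (h (cinner z a) *\<^sub>C a - s *\<^sub>C z))) (at z)"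
    unfolding Psi by (rule bounded_bilinear.FDERIV[OF bounded_bilinear_scaleC g has_derivative_diff[OF ha sz]])
  then show "\<exists>D. (Psi a has_derivative D) (at z) \<and> (\<forall>c v. D (c *\<^sub>C v) = c *\<^sub>C D v)"
    by (intro exI conjI) (assumption, simp add: scaleC_add_right scaleC_diff_right cinner_simps mult_ac)
qed

lemma holomorphic_ell2_unitary:
  assumes "unitary U"
  shows "holomorphic_ell2 U S"
proof -
  have "bounded_linear U"
    using assms unitary_norm[OF assms]
    by (intro bounded_linear_intro[where K = 1]) (auto simp: unitary_def scaleR_ell2_def)
  then show ?thesis
    using assms bounded_linear_imp_has_derivative unfolding holomorphic_ell2_def unitary_def by blast
qed

lemma holomorphic_ell2_compose:
  assumes "holomorphic_ell2 f S" "holomorphic_ell2 g T" "f ` S \<subseteq> T"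
  shows "holomorphic_ell2 (\<lambda>z. g (f z)) S"
  unfolding holomorphic_ell2_def
proof
  fix z assume "z \<in> S"
  then obtain D E where "(f has_derivative D) (at z)" "\<forall>c v. D (c *\<^sub>C v) = c *\<^sub>C D v"
    "(g has_derivative E) (at (f z))" "\<forall>c v. E (c *\<^sub>C v) = c *\<^sub>C E v"
    using assms unfolding holomorphic_ell2_def by blast
  then show "\<exists>D. ((\<lambda>z. g (f z)) has_derivative D) (at z) \<and> (\<forall>c v. D (c *\<^sub>C v) = c *\<^sub>C D v)"
    by (intro exI[of _ "\<lambda>v. E (D v)"]) (auto intro: has_derivative_compose)
qed

text \<open>\<open>inv_into\<close> agrees with \<open>g\<close> only on the ball; since the ball is
  open, its derivatives there are still those of \<open>g\<close>.\<close>

lemma Aut_ballI: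
  fixes f g :: "'d ell2 \<Rightarrow> 'd ell2"
  assumes "f ` ball 0 1 \<subseteq> ball 0 1" "g ` ball 0 1 \<subseteq> ball 0 1"
    and "\<And>z. z \<in> ball 0 1 \<Longrightarrow> g (f z) = z" "\<And>z. z \<in> ball 0 1 \<Longrightarrow> f (g z) = z"
    and "holomorphic_ell2 f (ball 0 1)" "holomorphic_ell2 g (ball 0 1)"
  shows "f \<in> Aut_ball"
proof -
  have bij: "bij_betw f (ball 0 1) (ball 0 1)"
    using assms by (intro bij_betw_byWitness[where f' = g]) auto
  have inv: "g z = inv_into (ball 0 1) f z" if "z \<in> ball 0 1" for z
  proof -
    have "g z \<in> ball 0 1" using assms(2) that by blast
    then show ?thesis
      using inv_into_f_f[OF bij_betw_imp_inj_on[OF bij], of "g z"] assms(4)[OF that] by simp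
  qed
  have "holomorphic_ell2 (inv_into (ball 0 1) f) (ball 0 1)"
    unfolding holomorphic_ell2_def
  proof
    fix z :: "'d ell2" assume z: "z \<in> ball 0 1"
    then obtain D where D: "(g has_derivative D) (at z)" "\<forall>c v. D (c *\<^sub>C v) = c *\<^sub>C D v"
      using assms(6) unfolding holomorphic_ell2_def by blast
    have "(inv_into (ball 0 1) f has_derivative D) (at z)"
      by (rule has_derivative_transform_within_open[OF D(1) open_ball z inv])
    then show "\<exists>D. (inv_into (ball 0 1) f has_derivative D) (at z) \<and> (\<forall>c v. D (c *\<^sub>C v) = c *\<^sub>C D v)"
      using D(2) by blast
  qed
  then show ?thesis using bij assms by (simp add: Aut_ball_def)
qed

text \<open>The automorphism that matches two configurations: \<open>Psi b\<close> brings
  \<open>b\<close> to the origin, \<open>U\<close> aligns the moved points, and \<open>Psi a\<close>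
  takes the origin to \<open>a\<close>.\<close>

lemma Psi_unitary_Psi_in_Aut_ball:
  assumes "norm a < 1" "norm b < 1" "unitary U"
  shows "(\<lambda>z. Psi a (U (Psi b z))) \<in> Aut_ball"
proof -
  define V where "V = inv U"
  have UV: "U (V z) = z" "V (U z) = z" for z
  proof -
    have "inj U"
    proof (rule injI)
      fix x y assume "U x = U y"
      then have "U (x - y) = 0" using unitary_diff[OF assms(3)] by simp
      then show "x = y" using unitary_norm[OF assms(3), of "x - y"] by simp
    qed
    moreover have "surj U" using assms by (simp add: unitary_def)
    ultimately show "U (V z) = z" "V (U z) = z" by (simp_all add: V_def surj_f_inv_f)
  qed
  have V: "unitary V"
    unfolding unitary_def
  proof (intro conjI allI)
    show "V (x + y) = V x + V y" for x y using assms(3) UV unfolding unitary_def by metis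
    show "V (c *\<^sub>C x) = c *\<^sub>C V x" for c x using assms(3) UV unfolding unitary_def by metis
    show "cinner (V x) (V y) = cinner x y" for x y using assms(3) UV unfolding unitary_def by metis
    show "surj V" using UV by (metis surjI)
  qed
  have B: "norm (Psi a z) < 1" "norm (Psi b z) < 1" "norm (U z) < 1" "norm (V z) < 1" if "norm z < 1" for z
    using that assms norm_Psi_less_1 unitary_norm[OF V] unitary_norm[OF assms(3)] by auto
  have conj: "holomorphic_ell2 (\<lambda>z. Psi c (W (Psi d z))) (ball 0 1)"
    if "norm c < 1" "norm d < 1" "unitary W" for c d :: "'a ell2" and W
  proof -
    have "holomorphic_ell2 (\<lambda>z. Psi c (W z)) (ball 0 1)"
      using that by (intro holomorphic_ell2_compose[OF holomorphic_ell2_unitary holomorphic_ell2_Psi])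
        (auto simp: unitary_norm)
    then show ?thesis
      using that by (intro holomorphic_ell2_compose[OF holomorphic_ell2_Psi]) (auto simp: norm_Psi_less_1)
  qed
  show ?thesis
  proof (rule Aut_ballI)
    show "(\<lambda>z. Psi a (U (Psi b z))) ` ball 0 1 \<subseteq> ball 0 1"
      "(\<lambda>z. Psi b (V (Psi a z))) ` ball 0 1 \<subseteq> ball 0 1"
      using B by auto
    show "Psi b (V (Psi a (Psi a (U (Psi b z))))) = z" "Psi a (U (Psi b (Psi b (V (Psi a z))))) = z"
      if "z \<in> ball 0 1" for z
      using that B by (simp_all add: Psi_Psi assms UV)
  qed (use conj assms V in auto)
qed

section \<open>Isomorphisms between finite-dimensional RKHSs\<close>

text \<open>Phrased through the values of a positive form at \<open>f + c g\<close>, so that it also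
  applies to a difference of two inner products. Choosing \<open>c\<close> as a negative real
  multiple of \<open>cnj q\<close> makes the cross term real, and \<open>t = 1 / b\<close> minimizes
  the resulting parabola.\<close>

lemma psd_form_Cauchy_Schwarz:
  fixes q :: complex and a b :: real
  assumes "\<And>c. 0 \<le> a + 2 * Re (c * q) + (cmod c)\<^sup>2 * b" "b \<ge> 0"
  shows "(cmod q)\<^sup>2 \<le> a * b"
proof -
  have *: "0 \<le> a - 2 * t * (cmod q)\<^sup>2 + t\<^sup>2 * (cmod q)\<^sup>2 * b" for t :: real
  proof -
    have "- of_real t * cnj q * q = of_real (- t * (cmod q)\<^sup>2)"
      using complex_norm_square[of q] by (simp add: mult_ac)
    then have "Re (- of_real t * cnj q * q) = - t * (cmod q)\<^sup>2" by (simp only: Re_complex_of_real)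
    then show ?thesis
      using assms(1)[of "- of_real t * cnj q"] by (simp add: norm_mult power_mult_distrib)
  qed
  show ?thesis
  proof (cases "b = 0")
    case True
    \<comment> \<open>Without a quadratic term, a nonzero \<open>q\<close> would allow negative
      values: the chosen \<open>t\<close> gives -1.\<close>
    have "q = 0"
    proof (rule ccontr)
      assume "q \<noteq> 0"
      then show False using *[of "(a + 1) / (2 * (cmod q)\<^sup>2)"] True by simp
    qed
    then show ?thesis using True by simp
  next
    case False
    then show ?thesis using *[of "1 / b"] assms(2) by (simp add: field_simps power2_eq_square)
  qed
qed

section \<open>Inner product calculus in an RKHS\<close>

locale reproducing_kernel_space =
  fixes H :: "'a fun_space"
  assumes rkhs: "rkhs H"
begin

lemma zero_mem: "(\<lambda>_. 0) \<in> elements H"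
  and add_mem: "\<And>f g. f \<in> elements H \<Longrightarrow> g \<in> elements H \<Longrightarrow> (\<lambda>z. f z + g z) \<in> elements H"
  and scale_mem: "\<And>c f. f \<in> elements H \<Longrightarrow> (\<lambda>z. c * f z) \<in> elements H"
  and vanish: "\<And>f z. f \<in> elements H \<Longrightarrow> z \<notin> points H \<Longrightarrow> f z = 0"
  and ip_add: "\<And>f g h. f \<in> elements H \<Longrightarrow> g \<in> elements H \<Longrightarrow> h \<in> elements H \<Longrightarrow>
    ip H (\<lambda>z. f z + g z) h = ip H f h + ip H g h"
  and ip_scale: "\<And>c f g. f \<in> elements H \<Longrightarrow> g \<in> elements H \<Longrightarrow> ip H (\<lambda>z. c * f z) g = c * ip H f g"
  and ip_commute: "\<And>f g. f \<in> elements H \<Longrightarrow> g \<in> elements H \<Longrightarrow> ip H f g = cnj (ip H g f)"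
  and ip_pos: "\<And>f. f \<in> elements H \<Longrightarrow> f \<noteq> (\<lambda>_. 0) \<Longrightarrow> 0 < Re (ip H f f)"
  and kernel_mem: "\<And>x. x \<in> points H \<Longrightarrow> kernel_fun H x \<in> elements H"
  and reproducing: "\<And>x f. x \<in> points H \<Longrightarrow> f \<in> elements H \<Longrightarrow> f x = ip H f (kernel_fun H x)"
  using rkhs unfolding rkhs_def by blast+

lemma ip_scale_right:
  assumes "f \<in> elements H" "g \<in> elements H"
  shows "ip H f (\<lambda>z. c * g z) = cnj c * ip H f g"
  using ip_commute[OF assms(1) scale_mem[OF assms(2)]] ip_scale[OF assms(2,1)] ip_commute[OF assms]
  by simp

lemma ip_add_right:
  assumes "f \<in> elements H" "g \<in> elements H" "h \<in> elements H"
  shows "ip H f (\<lambda>z. g z + h z) = ip H f g + ip H f h"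
  using ip_commute[OF assms(1) add_mem[OF assms(2,3)]] ip_add[OF assms(2,3,1)]
    ip_commute[OF assms(1,2)] ip_commute[OF assms(1,3)] by simp

lemma ip_zero: "ip H (\<lambda>_. 0) (\<lambda>_. 0) = 0"
  using ip_scale[OF zero_mem zero_mem, of 0] by simp

lemma ip_nonneg: "f \<in> elements H \<Longrightarrow> 0 \<le> Re (ip H f f)"
  using ip_pos[of f] ip_zero by (cases "f = (\<lambda>_. 0)") auto

lemma hnorm_nonneg: "f \<in> elements H \<Longrightarrow> 0 \<le> hnorm H f"
  by (simp add: hnorm_def ip_nonneg)

lemma hnorm_sq: "f \<in> elements H \<Longrightarrow> (hnorm H f)\<^sup>2 = Re (ip H f f)"
  by (simp add: hnorm_def ip_nonneg)

lemma hnorm_pos: "f \<in> elements H \<Longrightarrow> f \<noteq> (\<lambda>_. 0) \<Longrightarrow> 0 < hnorm H f"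
  by (simp add: hnorm_def ip_pos)

lemma hnorm_scale:
  assumes "f \<in> elements H"
  shows "hnorm H (\<lambda>z. c * f z) = cmod c * hnorm H f"
proof (rule power2_eq_imp_eq)
  have "ip H (\<lambda>z. c * f z) (\<lambda>z. c * f z) = (c * cnj c) * ip H f f"
    using assms by (simp add: ip_scale ip_scale_right scale_mem)
  also have "\<dots> = of_real ((cmod c)\<^sup>2) * ip H f f" by (simp flip: complex_norm_square)
  finally show "(hnorm H (\<lambda>z. c * f z))\<^sup>2 = (cmod c * hnorm H f)\<^sup>2"
    using assms by (simp only: hnorm_sq scale_mem power_mult_distrib) simp
qed (use assms in \<open>auto intro!: hnorm_nonneg scale_mem mult_nonneg_nonneg\<close>)

lemma hnorm_add_scale_sq:
  assumes "f \<in> elements H" "g \<in> elements H"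
  shows "(hnorm H (\<lambda>z. f z + c * g z))\<^sup>2 =
    (hnorm H f)\<^sup>2 + 2 * Re (c * ip H g f) + (cmod c)\<^sup>2 * (hnorm H g)\<^sup>2"
proof -
  note m = assms scale_mem[OF assms(2)]
  have "ip H (\<lambda>z. f z + c * g z) (\<lambda>z. f z + c * g z) =
      ip H f f + (c * ip H g f + cnj (c * ip H g f)) + (c * cnj c) * ip H g g"
    using ip_commute[OF assms]
    by (simp add: ip_add ip_add_right ip_scale ip_scale_right m add_mem algebra_simps)
  also have "c * cnj c = of_real ((cmod c)\<^sup>2)" by (simp only: complex_norm_square)
  finally show ?thesis
    unfolding hnorm_sq[OF add_mem[OF m(1,3)]] hnorm_sq[OF m(1)] hnorm_sq[OF m(2)]
    by (simp del: of_real_power)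
qed

lemma ip_Cauchy_Schwarz:
  assumes "f \<in> elements H" "g \<in> elements H"
  shows "cmod (ip H f g) \<le> hnorm H f * hnorm H g"
proof (rule power2_le_imp_le)
  have "(cmod (ip H f g))\<^sup>2 \<le> (hnorm H g)\<^sup>2 * (hnorm H f)\<^sup>2"
    using hnorm_add_scale_sq[OF assms(2,1)]
    by (intro psd_form_Cauchy_Schwarz) (metis zero_le_power2, simp)
  then show "(cmod (ip H f g))\<^sup>2 \<le> (hnorm H f * hnorm H g)\<^sup>2"
    by (simp add: power_mult_distrib mult.commute)
qed (use assms hnorm_nonneg in auto)

lemma hnorm_triangle:
  assumes "f \<in> elements H" "g \<in> elements H"
  shows "hnorm H (\<lambda>z. f z + g z) \<le> hnorm H f + hnorm H g"
proof (rule power2_le_imp_le)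
  have "Re (ip H g f) \<le> hnorm H g * hnorm H f"
    using ip_Cauchy_Schwarz[OF assms(2,1)] complex_Re_le_cmod order_trans by blast
  then show "(hnorm H (\<lambda>z. f z + g z))\<^sup>2 \<le> (hnorm H f + hnorm H g)\<^sup>2"
    using hnorm_add_scale_sq[OF assms, of 1] by (simp add: power2_sum mult.commute)
qed (use assms hnorm_nonneg in auto)

lemma ip_kernel: "x \<in> points H \<Longrightarrow> y \<in> points H \<Longrightarrow> ip H (kernel_fun H y) (kernel_fun H x) = kernel H x y"
  using reproducing[OF _ kernel_mem, of x y] by (metis kernel_fun_def)

lemma hnorm_kernel: "x \<in> points H \<Longrightarrow> hnorm H (kernel_fun H x) = sqrt (Re (kernel H x x))"
  by (simp add: hnorm_def ip_kernel)

end

text \<open>Used to bound the inverse of an isomorphism. \<open>W\<close> is an arbitrary subspace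
  and need not contain indicator functions, so a point \<open>p\<close> is removed by subtracting
  multiples of some \<open>b\<close> in \<open>W\<close> with \<open>b p = 1\<close>; if there is
  none, all of \<open>W\<close> vanishes at \<open>p\<close>.\<close>

lemma seminorm_bounded_finite_support:
  fixes q :: "('a \<Rightarrow> complex) \<Rightarrow> real"
  assumes "finite P" "\<And>f z. f \<in> W \<Longrightarrow> z \<notin> P \<Longrightarrow> f z = 0"
    and add: "\<And>f g. f \<in> W \<Longrightarrow> g \<in> W \<Longrightarrow> (\<lambda>z. f z + g z) \<in> W"
    and scale: "\<And>c f. f \<in> W \<Longrightarrow> (\<lambda>z. c * f z) \<in> W"
    and "\<And>f. f \<in> W \<Longrightarrow> 0 \<le> q f"
    and "\<And>f g. f \<in> W \<Longrightarrow> g \<in> W \<Longrightarrow> q (\<lambda>z. f z + g z) \<le> q f + q g"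
    and "\<And>c f. f \<in> W \<Longrightarrow> q (\<lambda>z. c * f z) = cmod c * q f"
  shows "\<exists>M\<ge>0. \<forall>f\<in>W. q f \<le> M * (\<Sum>p\<in>P. cmod (f p))"
  using assms
proof (induction P arbitrary: W rule: finite_induct)
  case empty
  have "q f \<le> 0" if "f \<in> W" for f
  proof -
    have "(\<lambda>z. 0 * f z) = f" using empty(1)[OF that] by auto
    then show ?thesis using empty(6)[OF that, of 0] by simp
  qed
  then show ?case by (intro exI[of _ 0]) auto
next
  case (insert p P)
  show ?case
  proof (cases "\<forall>f\<in>W. f p = 0")
    case True
    have "\<exists>M\<ge>0. \<forall>f\<in>W. q f \<le> M * (\<Sum>p\<in>P. cmod (f p))"
    proof (rule insert.IH)
      show "f z = 0" if "f \<in> W" "z \<notin> P" for f z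
        using that insert.prems(1)[of f z] True by auto
    qed (fact insert.prems)+
    then obtain M where "M \<ge> 0" "\<forall>f\<in>W. q f \<le> M * (\<Sum>p\<in>P. cmod (f p))" by blast
    then show ?thesis using True insert.hyps by (intro exI[of _ M] conjI ballI) auto
  next
    case False
    then obtain b' where b': "b' \<in> W" "b' p \<noteq> 0" by blast
    define b where "b = (\<lambda>z. (1 / b' p) * b' z)"
    have b: "b \<in> W" "b p = 1"
      using b' insert.prems(3)[OF b'(1)] by (simp_all only: b_def) simp
    define W' where "W' = {f \<in> W. f p = 0}"
    have "\<exists>M\<ge>0. \<forall>f\<in>W'. q f \<le> M * (\<Sum>p\<in>P. cmod (f p))"
    proof (rule insert.IH)
      show "f z = 0" if "f \<in> W'" "z \<notin> P" for f z
        using that insert.prems(1)[of f z] by (auto simp: W'_def)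
    qed (use insert.prems in \<open>auto simp: W'_def\<close>)
    then obtain M where M: "M \<ge> 0" "\<And>f. f \<in> W' \<Longrightarrow> q f \<le> M * (\<Sum>p\<in>P. cmod (f p))" by blast
    define S where "S = (\<Sum>z\<in>P. cmod (b z))"
    have S: "S \<ge> 0" by (simp add: S_def sum_nonneg)
    have qb: "q b \<ge> 0" using insert.prems(4) b by blast
    have "q f \<le> (M + M * S + q b) * (\<Sum>p\<in>insert p P. cmod (f p))" if f: "f \<in> W" for f
    proof -
      define g where "g = (\<lambda>z. f z + (- f p) * b z)"
      have g: "g \<in> W'" using insert.prems(2)[OF f insert.prems(3)[OF b(1), of "- f p"]] b(2)
        by (simp add: W'_def g_def)
      then have gW: "g \<in> W" by (simp add: W'_def)
      have "f = (\<lambda>z. g z + f p * b z)" by (auto simp: g_def)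
      then have "q f \<le> q g + cmod (f p) * q b"
        using insert.prems(5)[OF gW insert.prems(3)[OF b(1), of "f p"]] insert.prems(6)[OF b(1), of "f p"]
        by simp
      moreover have "q g \<le> M * (\<Sum>z\<in>P. cmod (g z))" using M(2)[OF g] .
      moreover have "(\<Sum>z\<in>P. cmod (g z)) \<le> (\<Sum>z\<in>P. cmod (f z) + cmod (f p) * cmod (b z))"
        unfolding g_def by (intro sum_mono order_trans[OF norm_triangle_ineq]) (simp add: norm_mult)
      then have "M * (\<Sum>z\<in>P. cmod (g z)) \<le> M * ((\<Sum>z\<in>P. cmod (f z)) + cmod (f p) * S)"
        using M(1) by (intro mult_left_mono) (auto simp: sum.distrib S_def sum_distrib_left)
      ultimately have "q f \<le> M * (\<Sum>z\<in>P. cmod (f z)) + (M * S + q b) * cmod (f p)"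
        by (simp add: algebra_simps)
      also have "\<dots> \<le> (M + M * S + q b) * (\<Sum>z\<in>P. cmod (f z)) + (M + M * S + q b) * cmod (f p)"
        using M(1) S qb by (intro add_mono mult_right_mono sum_nonneg) auto
      also have "\<dots> = (M + M * S + q b) * (\<Sum>p\<in>insert p P. cmod (f p))"
        using insert.hyps by (simp add: algebra_simps)
      finally show ?thesis .
    qed
    moreover have "M + M * S + q b \<ge> 0" using M(1) S qb by simp
    ultimately show ?thesis by blast
  qed
qed

text \<open>\<open>op_norm\<close> is a real \<open>Sup\<close>, which is an upper bound only if the
  set is bounded above. Hence some bound \<open>M\<close> has to be known beforehand.\<close>

lemma hnorm_le_op_norm:
  assumes "rkhs H" "rkhs K" "f \<in> elements H"
    and mem: "\<And>f. f \<in> elements H \<Longrightarrow> T f \<in> elements K"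
    and hom: "\<And>c f. f \<in> elements H \<Longrightarrow> T (\<lambda>z. c * f z) = (\<lambda>z. c * T f z)"
    and bdd: "\<And>f. f \<in> elements H \<Longrightarrow> hnorm K (T f) \<le> M * hnorm H f"
  shows "hnorm K (T f) \<le> op_norm H K T * hnorm H f"
proof -
  interpret H: reproducing_kernel_space H by unfold_locales fact
  interpret K: reproducing_kernel_space K by unfold_locales fact
  show ?thesis
  proof (cases "f = (\<lambda>_. 0)")
    case True
    then have "hnorm H f = 0" by (simp add: hnorm_def H.ip_zero)
    then show ?thesis using bdd[OF assms(3)] by simp
  next
    case False
    then have pos: "hnorm H f > 0" using H.hnorm_pos assms(3) by blast
    define u where "u = (\<lambda>z. of_real (1 / hnorm H f) * f z)"
    have u: "u \<in> elements H" unfolding u_def by (rule H.scale_mem[OF assms(3)])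
    have u1: "hnorm H u = 1"
      unfolding u_def H.hnorm_scale[OF assms(3)] norm_of_real using pos by simp
    have "hnorm K (T u) \<le> op_norm H K T"
      unfolding op_norm_def
    proof (rule cSup_upper)
      have "hnorm K (T g) \<le> \<bar>M\<bar>" if "g \<in> elements H" "hnorm H g \<le> 1" for g
      proof -
        have "M * hnorm H g \<le> \<bar>M\<bar> * 1"
          using that H.hnorm_nonneg by (intro mult_mono) auto
        then show ?thesis using bdd[OF that(1)] by simp
      qed
      then show "bdd_above {hnorm K (T f) |f. f \<in> elements H \<and> hnorm H f \<le> 1}"
        by (intro bdd_aboveI[of _ "\<bar>M\<bar>"]) auto
    qed (use u u1 in auto)
    moreover have "hnorm K (T u) = hnorm K (T f) / hnorm H f"
      using pos unfolding u_def hom[OF assms(3)] K.hnorm_scale[OF mem[OF assms(3)]] norm_of_real by simp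
    ultimately show ?thesis using pos by (simp add: field_simps)
  qed
qed

lemma rkhs_iso_norm_bounds:
  assumes "rkhs H" "rkhs K" "finite (points K)" "rkhs_iso H K T" "f \<in> elements H"
  defines "S \<equiv> inv_into (elements H) T"
  shows "hnorm K (T f) \<le> op_norm H K T * hnorm H f"
    and "hnorm H f \<le> op_norm K H S * hnorm K (T f)"
proof -
  interpret H: reproducing_kernel_space H by unfold_locales fact
  interpret K: reproducing_kernel_space K by unfold_locales fact
  have Tadd: "T (\<lambda>z. f z + g z) = (\<lambda>z. T f z + T g z)" if "f \<in> elements H" "g \<in> elements H" for f g
    using assms(4) that unfolding rkhs_iso_def by blast
  have Tsc: "T (\<lambda>z. c * f z) = (\<lambda>z. c * T f z)" if "f \<in> elements H" for c f
    using assms(4) that unfolding rkhs_iso_def by blast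
  have bij: "bij_betw T (elements H) (elements K)" using assms(4) unfolding rkhs_iso_def by blast
  then have Tm: "T f \<in> elements K" if "f \<in> elements H" for f using that bij_betwE by blast
  obtain M where "\<And>f. f \<in> elements H \<Longrightarrow> hnorm K (T f) \<le> M * hnorm H f"
    using assms(4) unfolding rkhs_iso_def by blast
  then show "hnorm K (T f) \<le> op_norm H K T * hnorm H f"
    by (intro hnorm_le_op_norm assms Tm Tsc)
  have Sm: "S g \<in> elements H" if "g \<in> elements K" for g
    using that bij unfolding S_def by (metis bij_betw_def inv_into_into)
  have TS: "T (S g) = g" if "g \<in> elements K" for g
    using that bij unfolding S_def by (metis bij_betw_def f_inv_into_f)
  have ST: "S (T f) = f" if "f \<in> elements H" for f
    using that bij unfolding S_def by (metis bij_betw_def inv_into_f_f)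
  have Sadd: "S (\<lambda>z. f z + g z) = (\<lambda>z. S f z + S g z)" if "f \<in> elements K" "g \<in> elements K" for f g
    using ST[OF H.add_mem[OF Sm[OF that(1)] Sm[OF that(2)]]] Tadd[OF Sm[OF that(1)] Sm[OF that(2)]] TS that
    by simp
  have Ssc: "S (\<lambda>z. c * f z) = (\<lambda>z. c * S f z)" if "f \<in> elements K" for c f
    using ST[OF H.scale_mem[OF Sm[OF that]]] Tsc[OF Sm[OF that]] TS that by simp
  \<comment> \<open>\<open>rkhs_iso\<close> demands boundedness of \<open>T\<close> only. For the
    inverse, finiteness of the point set bounds \<open>S\<close> by the values of \<open>g\<close>,
    and the reproducing property bounds these by the norm of \<open>g\<close>.\<close>
  have "\<exists>M\<ge>0. \<forall>g\<in>elements K. hnorm H (S g) \<le> M * (\<Sum>p\<in>points K. cmod (g p))"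
    by (rule seminorm_bounded_finite_support)
       (auto simp: assms(3) K.vanish K.add_mem K.scale_mem Sadd Ssc Sm H.hnorm_nonneg H.hnorm_triangle H.hnorm_scale)
  then obtain M where M: "M \<ge> 0" "\<And>g. g \<in> elements K \<Longrightarrow> hnorm H (S g) \<le> M * (\<Sum>p\<in>points K. cmod (g p))"
    by blast
  have "hnorm H (S g) \<le> (M * (\<Sum>p\<in>points K. hnorm K (kernel_fun K p))) * hnorm K g"
    if g: "g \<in> elements K" for g
  proof -
    have "(\<Sum>p\<in>points K. cmod (g p)) \<le> (\<Sum>p\<in>points K. hnorm K g * hnorm K (kernel_fun K p))"
    proof (rule sum_mono)
      fix p assume "p \<in> points K"
      then show "cmod (g p) \<le> hnorm K g * hnorm K (kernel_fun K p)"
        using K.ip_Cauchy_Schwarz[OF g K.kernel_mem] K.reproducing[OF _ g] by metis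
    qed
    then have "(\<Sum>p\<in>points K. cmod (g p)) \<le> (\<Sum>p\<in>points K. hnorm K (kernel_fun K p)) * hnorm K g"
      by (simp add: mult.commute flip: sum_distrib_left)
    from order_trans[OF M(2)[OF g] mult_left_mono[OF this M(1)]]
    show ?thesis by (simp add: mult.assoc)
  qed
  then have "hnorm H (S (T f)) \<le> op_norm K H S * hnorm K (T f)"
    by (intro hnorm_le_op_norm assms Tm Ssc Sm)
  then show "hnorm H f \<le> op_norm K H S * hnorm K (T f)" using ST assms by simp
qed

text \<open>With \<open>k\<close>, \<open>l\<close> the norms of \<open>T\<close> and its inverse, \<open>k\<^sup>2 \<parallel>f\<parallel>\<^sup>2 - \<parallel>T f\<parallel>\<^sup>2\<close> is a positive form that is
  at most \<open>(k\<^sup>2 - 1 / l\<^sup>2) \<parallel>f\<parallel>\<^sup>2\<close>; the Cauchy-Schwarz inequality for it compares the Gram matrices.\<close>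

lemma rkhs_iso_kernel_close:
  assumes "rkhs H" "rkhs K" "finite (points K)" "rkhs_iso H K T" "a \<in> points H" "kernel H a a \<noteq> 0"
  defines "d \<equiv> op_norm H K T * op_norm K H (inv_into (elements H) T)"
  shows "d \<ge> 1"
    and "\<exists>F l. bij_betw F (points H) (points K) \<and> (\<forall>x\<in>points H. l x \<noteq> 0) \<and>
      (\<forall>x\<in>points H. \<forall>y\<in>points H.
        cmod (kernel H x y - l y * cnj (l x) * kernel K (F x) (F y)) \<le>
        (1 - 1 / d\<^sup>2) * (sqrt (Re (kernel H x x)) * sqrt (Re (kernel H y y))))"
proof -
  interpret H: reproducing_kernel_space H by unfold_locales fact
  interpret K: reproducing_kernel_space K by unfold_locales fact
  define k l where "k = op_norm H K T" and "l = op_norm K H (inv_into (elements H) T)"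
  have d: "d = k * l" by (simp add: d_def k_def l_def)
  have kb: "hnorm K (T f) \<le> k * hnorm H f" and lb: "hnorm H f \<le> l * hnorm K (T f)"
    if "f \<in> elements H" for f
    using rkhs_iso_norm_bounds[OF assms(1-4) that] by (simp_all add: k_def l_def)
  have Tadd: "T (\<lambda>z. f z + g z) = (\<lambda>z. T f z + T g z)" if "f \<in> elements H" "g \<in> elements H" for f g
    using assms(4) that unfolding rkhs_iso_def by blast
  have Tsc: "T (\<lambda>z. c * f z) = (\<lambda>z. c * T f z)" if "f \<in> elements H" for c f
    using assms(4) that unfolding rkhs_iso_def by blast
  have Tm: "T f \<in> elements K" if "f \<in> elements H" for f
    using that bij_betwE assms(4) unfolding rkhs_iso_def by blast
  have ka: "kernel_fun H a \<in> elements H" using H.kernel_mem assms by blast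
  \<comment> \<open>A nonzero element excludes the zero space, so that \<open>k\<close> and
    \<open>l\<close> are positive and can be divided by.\<close>
  have "kernel_fun H a \<noteq> (\<lambda>_. 0)"
    using assms(5,6) by (auto simp: kernel_fun_def fun_eq_iff)
  then have pos: "hnorm H (kernel_fun H a) > 0" by (rule H.hnorm_pos[OF ka])
  have Tpos: "hnorm K (T (kernel_fun H a)) > 0"
    using lb[OF ka] pos K.hnorm_nonneg[OF Tm[OF ka]] by (cases "hnorm K (T (kernel_fun H a)) = 0") auto
  have k: "k > 0"
    using kb[OF ka] pos Tpos by (metis less_le_trans zero_less_mult_pos2)
  have l: "l > 0"
    using lb[OF ka] pos Tpos by (metis less_le_trans zero_less_mult_pos2)
  have "hnorm H (kernel_fun H a) \<le> l * (k * hnorm H (kernel_fun H a))"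
    using lb[OF ka] mult_left_mono[OF kb[OF ka], of l] l by linarith
  then show "d \<ge> 1" using pos by (simp add: d mult_ac)
  have close: "cmod (ip H g f - ip K (T g) (T f) / of_real (k\<^sup>2)) \<le> (1 - 1 / d\<^sup>2) * (hnorm H f * hnorm H g)"
    if fg: "f \<in> elements H" "g \<in> elements H" for f g
  proof -
    define e where "e h = k\<^sup>2 * (hnorm H h)\<^sup>2 - (hnorm K (T h))\<^sup>2" for h
    define q where "q = of_real (k\<^sup>2) * ip H g f - ip K (T g) (T f)"
    have e0: "0 \<le> e h" if "h \<in> elements H" for h
      unfolding e_def using power_mono[OF kb[OF that] K.hnorm_nonneg[OF Tm[OF that]], of 2]
      by (simp add: power_mult_distrib)
    have e1: "e h \<le> k\<^sup>2 * (1 - 1 / d\<^sup>2) * (hnorm H h)\<^sup>2" if "h \<in> elements H" for h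
    proof -
      have "(hnorm H h)\<^sup>2 \<le> l\<^sup>2 * (hnorm K (T h))\<^sup>2"
        using power_mono[OF lb[OF that] H.hnorm_nonneg[OF that], of 2] by (simp add: power_mult_distrib)
      then have "(hnorm H h)\<^sup>2 / l\<^sup>2 \<le> (hnorm K (T h))\<^sup>2" using l by (simp add: field_simps)
      moreover have "k\<^sup>2 * (1 - 1 / d\<^sup>2) * (hnorm H h)\<^sup>2 = k\<^sup>2 * (hnorm H h)\<^sup>2 - (hnorm H h)\<^sup>2 / l\<^sup>2"
        using k l by (simp add: d power_mult_distrib field_simps)
      ultimately show ?thesis by (simp add: e_def)
    qed
    have "0 \<le> e f + 2 * Re (c * q) + (cmod c)\<^sup>2 * e g" for c
    proof -
      have "e (\<lambda>z. f z + c * g z) = e f + 2 * Re (c * q) + (cmod c)\<^sup>2 * e g"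
        unfolding e_def Tadd[OF fg(1) H.scale_mem[OF fg(2)]] Tsc[OF fg(2)]
          H.hnorm_add_scale_sq[OF fg] K.hnorm_add_scale_sq[OF Tm[OF fg(1)] Tm[OF fg(2)]] q_def
        by (simp add: algebra_simps)
      then show ?thesis using e0[OF H.add_mem[OF fg(1) H.scale_mem[OF fg(2)]]] by metis
    qed
    then have "(cmod q)\<^sup>2 \<le> e f * e g"
      by (rule psd_form_Cauchy_Schwarz) (rule e0[OF fg(2)])
    also have "\<dots> \<le> (k\<^sup>2 * (1 - 1 / d\<^sup>2) * (hnorm H f)\<^sup>2) * (k\<^sup>2 * (1 - 1 / d\<^sup>2) * (hnorm H g)\<^sup>2)"
      using e0 e1 fg by (intro mult_mono order_trans[OF e0 e1]) auto
    also have "\<dots> = (k\<^sup>2 * ((1 - 1 / d\<^sup>2) * (hnorm H f * hnorm H g)))\<^sup>2"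
      by (simp add: power2_eq_square mult_ac)
    finally have "cmod q \<le> k\<^sup>2 * ((1 - 1 / d\<^sup>2) * (hnorm H f * hnorm H g))"
    proof (rule power2_le_imp_le)
      have "1 / d\<^sup>2 \<le> 1"
        using one_le_power[OF \<open>d \<ge> 1\<close>, of 2] by (simp add: divide_le_eq_1)
      then show "0 \<le> k\<^sup>2 * ((1 - 1 / d\<^sup>2) * (hnorm H f * hnorm H g))"
        using fg H.hnorm_nonneg by (intro mult_nonneg_nonneg) auto
    qed
    moreover have "ip H g f - ip K (T g) (T f) / of_real (k\<^sup>2) = q / of_real (k\<^sup>2)"
      using k by (simp add: q_def diff_divide_distrib)
    ultimately show ?thesis
      using k by (simp only: norm_divide norm_of_real) (simp add: pos_divide_le_eq mult.commute)
  qed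
  obtain F l' where F: "bij_betw F (points H) (points K)"
    and l': "\<And>x. x \<in> points H \<Longrightarrow> l' x \<noteq> 0"
      "\<And>x. x \<in> points H \<Longrightarrow> T (kernel_fun H x) = (\<lambda>z. l' x * kernel_fun K (F x) z)"
    using assms(4) unfolding rkhs_iso_def by blast
  \<comment> \<open>The factor \<open>1 / k\<^sup>2\<close> is split evenly between the two weights,
    so that the error depends on \<open>T\<close> only through \<open>d\<close>.\<close>
  have "cmod (kernel H x y - (l' y / of_real k) * cnj (l' x / of_real k) * kernel K (F x) (F y)) \<le>
        (1 - 1 / d\<^sup>2) * (sqrt (Re (kernel H x x)) * sqrt (Re (kernel H y y)))"
    if xy: "x \<in> points H" "y \<in> points H" for x y
  proof -
    have Fxy: "F x \<in> points K" "F y \<in> points K" using F xy bij_betwE by blast+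
    have "ip K (T (kernel_fun H y)) (T (kernel_fun H x)) = l' y * cnj (l' x) * kernel K (F x) (F y)"
      unfolding l'(2)[OF xy(1)] l'(2)[OF xy(2)]
      by (simp add: K.ip_scale K.ip_scale_right K.scale_mem K.kernel_mem Fxy K.ip_kernel)
    then show ?thesis
      using close[OF H.kernel_mem[OF xy(1)] H.kernel_mem[OF xy(2)]] xy
      by (simp add: H.ip_kernel H.hnorm_kernel power2_eq_square mult_ac)
  qed
  then show "\<exists>F l. bij_betw F (points H) (points K) \<and> (\<forall>x\<in>points H. l x \<noteq> 0) \<and>
      (\<forall>x\<in>points H. \<forall>y\<in>points H.
        cmod (kernel H x y - l y * cnj (l x) * kernel K (F x) (F y)) \<le>
        (1 - 1 / d\<^sup>2) * (sqrt (Re (kernel H x x)) * sqrt (Re (kernel H y y))))"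
    using F l'(1) k by (intro exI[of _ F] exI[of _ "\<lambda>x. l' x / of_real k"]) auto
qed

section \<open>From kernels to point configurations\<close>

definition da_kernel :: "'d ell2 \<Rightarrow> 'd ell2 \<Rightarrow> complex" where
  "da_kernel z w = 1 / (1 - cinner z w)"

lemma da_kernel_self: "da_kernel z z = of_real (1 / (1 - (norm z)\<^sup>2))"
  by (simp add: da_kernel_def cinner_norm)

lemma da_kernel_nonzero: "norm z < 1 \<Longrightarrow> norm w < 1 \<Longrightarrow> da_kernel z w \<noteq> 0"
  using norm_less_1_cinner_neq_1[of z w] by (simp add: da_kernel_def)

lemma cinner_Psi_Psi:
  assumes "norm a < 1" "norm z < 1" "norm w < 1"
  shows "cinner (Psi a z) (Psi a w) =
    1 - da_kernel z a * da_kernel a w / (da_kernel z w * da_kernel a a)"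
  using one_minus_cinner_Psi[OF assms] norm_less_1_cinner_neq_1 assms
  by (simp add: da_kernel_def algebra_simps)

text \<open>Through this identity the bound \<open>r\<close> on the distances within
  \<open>X\<close> becomes the lower bound \<open>sqrt (1 - r\<^sup>2)\<close> on its normalized
  Gram entries.\<close>

lemma normalized_da_kernel_sq:
  assumes "norm z < 1" "norm w < 1"
  shows "(cmod (da_kernel z w) / (sqrt (Re (da_kernel z z)) * sqrt (Re (da_kernel w w))))\<^sup>2
    = 1 - (rho_ph z w)\<^sup>2"
proof -
  have "1 - (norm z)\<^sup>2 > 0" "1 - (norm w)\<^sup>2 > 0" using assms by (simp_all add: abs_square_less_1)
  then show ?thesis
    using norm_less_1_cinner_neq_1[OF assms]
    by (simp add: rho_ph_sq[OF assms] da_kernel_self power_divide power_mult_distrib)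
       (simp add: da_kernel_def norm_divide power_divide)
qed

text \<open>The primed entries belong to \<open>Y\<close>, and \<open>2 * \<eta> \<le> c\<close>
  transfers the bounds to them. The entry \<open>e'\<close> has the counterpart 1, a normalized
  diagonal entry of \<open>X\<close>. The constant is the quotient of \<open>6 * \<eta>\<close> by
  the lower bound \<open>c\<^sup>2 / 4\<close> for the common denominator.\<close>

lemma ratio_perturb:
  fixes a b d a' b' d' e' :: complex and c \<eta> :: real
  assumes "cmod (a - a') \<le> \<eta>" "cmod (b - b') \<le> \<eta>" "cmod (d - d') \<le> \<eta>" "cmod (1 - e') \<le> \<eta>"
    and "cmod a \<le> 1" "cmod b \<le> 1" "cmod d \<le> 1" "c \<le> cmod d" "0 < c" "2 * \<eta> \<le> c"
  shows "cmod (a * b / d - a' * b' / (d' * e')) \<le> 24 * \<eta> / c\<^sup>2"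
proof -
  have \<eta>: "0 \<le> \<eta>" "\<eta> \<le> 1 / 2" using assms norm_ge_zero[of "a - a'"] by linarith+
  have d': "c / 2 \<le> cmod d'" "cmod d' \<le> 2"
    using norm_triangle_ineq2[of d d'] norm_triangle_ineq2[of d' d] assms \<eta>
    by (auto simp: norm_minus_commute)
  have e': "1 / 2 \<le> cmod e'" using norm_triangle_ineq2[of 1 e'] assms \<eta> by auto
  have b': "cmod b' \<le> 2"
    using norm_triangle_ineq2[of b' b] assms \<eta> by (auto simp: norm_minus_commute)
  have nz: "d \<noteq> 0" "d' \<noteq> 0" "e' \<noteq> 0" using assms d' e' by auto
  \<comment> \<open>The numerator over the common denominator, telescoped so that each summand
    contains exactly one small difference.\<close>
  define N where "N = (a * b) * (d' * (e' - 1) + (d' - d)) + d * (a * (b - b') + (a - a') * b')"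
  have "cmod (d' * (e' - 1) + (d' - d)) \<le> 2 * \<eta> + \<eta>"
    using assms d' \<eta> by (intro norm_triangle_mono) (auto simp: norm_mult norm_minus_commute intro: mult_mono)
  moreover have "cmod (a * b) \<le> 1 * 1" unfolding norm_mult using assms by (intro mult_mono) auto
  ultimately have 1: "cmod ((a * b) * (d' * (e' - 1) + (d' - d))) \<le> 1 * (2 * \<eta> + \<eta>)"
    unfolding norm_mult[of "a * b"] by (intro mult_mono) auto
  have "cmod (a * (b - b')) \<le> 1 * \<eta>" "cmod ((a - a') * b') \<le> \<eta> * 2"
    unfolding norm_mult using assms b' \<eta> by (intro mult_mono; simp)+
  then have "cmod (a * (b - b') + (a - a') * b') \<le> 1 * \<eta> + \<eta> * 2" by (rule norm_triangle_mono)
  then have 2: "cmod (d * (a * (b - b') + (a - a') * b')) \<le> 1 * (1 * \<eta> + \<eta> * 2)"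
    unfolding norm_mult[of d] using assms by (intro mult_mono) auto
  have N: "cmod N \<le> 6 * \<eta>"
    unfolding N_def using norm_triangle_mono[OF 1 2] by simp
  have D: "c * (c / 2 * (1 / 2)) \<le> cmod (d * (d' * e'))"
    unfolding norm_mult using assms d' e' by (intro mult_mono) auto
  have "a * b / d - a' * b' / (d' * e') = N / (d * (d' * e'))"
    using nz by (simp add: N_def divide_simps) (simp add: algebra_simps)
  then have "cmod (a * b / d - a' * b' / (d' * e')) \<le> 6 * \<eta> / (c * (c / 2 * (1 / 2)))"
    unfolding norm_divide using N D assms \<eta> by (simp only: norm_divide) (intro frac_le, auto)
  also have "\<dots> = 24 * \<eta> / c\<^sup>2" by (simp add: power2_eq_square)
  finally show ?thesis .
qed

lemma cinner_Psi_close: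
  fixes x y :: "nat \<Rightarrow> 'd ell2" and l :: "nat \<Rightarrow> complex"
  assumes x: "\<And>i. i < n \<Longrightarrow> norm (x i) < 1" and y: "\<And>i. i < n \<Longrightarrow> norm (y i) < 1"
    and l: "\<And>i. i < n \<Longrightarrow> l i \<noteq> 0"
    and close: "\<And>i j. i < n \<Longrightarrow> j < n \<Longrightarrow>
      cmod (da_kernel (x i) (x j) - l j * cnj (l i) * da_kernel (y i) (y j)) \<le>
      \<eta> * (sqrt (Re (da_kernel (x i) (x i))) * sqrt (Re (da_kernel (x j) (x j))))"
    and r: "\<And>i j. i < n \<Longrightarrow> j < n \<Longrightarrow> rho_ph (x i) (x j) \<le> r" "r < 1"
    and "2 * \<eta> \<le> sqrt (1 - r\<^sup>2)" and n: "0 < n" "i < n" "j < n"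
  shows "cmod (cinner (Psi (x 0) (x i)) (Psi (x 0) (x j)) - cinner (Psi (y 0) (y i)) (Psi (y 0) (y j)))
    \<le> 24 * \<eta> / (sqrt (1 - r\<^sup>2))\<^sup>2"
proof -
  define s where "s i = sqrt (Re (da_kernel (x i) (x i)))" for i
  have s: "s i > 0" "complex_of_real (s i * s i) = da_kernel (x i) (x i)" if "i < n" for i
  proof -
    have "1 / (1 - (norm (x i))\<^sup>2) > 0" using x[OF that] by (simp add: abs_square_less_1)
    then show "s i > 0" "complex_of_real (s i * s i) = da_kernel (x i) (x i)"
      by (simp_all add: s_def da_kernel_self)
  qed
  define G where "G i j = da_kernel (x i) (x j) / (s i * s j)" for i j
  \<comment> \<open>The entries of \<open>Y\<close> are divided by the kernel norms of
    \<open>X\<close>. In the ratio \<open>M i 0 * M 0 j / (M i j * M 0 0)\<close> these norms and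
    the weights \<open>l\<close> all cancel.\<close>
  define M where "M i j = l j * cnj (l i) * da_kernel (y i) (y j) / (s i * s j)" for i j
  have Gx: "cinner (Psi (x 0) (x i)) (Psi (x 0) (x j)) = 1 - G i 0 * G 0 j / G i j"
    unfolding cinner_Psi_Psi[OF x[OF n(1)] x[OF n(2)] x[OF n(3)]] s(2)[OF n(1), symmetric] G_def
    using s(1)[OF n(1)] s(1)[OF n(2)] s(1)[OF n(3)] by (simp add: field_simps)
  have My: "cinner (Psi (y 0) (y i)) (Psi (y 0) (y j)) = 1 - M i 0 * M 0 j / (M i j * M 0 0)"
    unfolding cinner_Psi_Psi[OF y[OF n(1)] y[OF n(2)] y[OF n(3)]] M_def
    using s(1)[OF n(1)] s(1)[OF n(2)] s(1)[OF n(3)] l n by (simp add: field_simps)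
  have GM: "cmod (G i j - M i j) \<le> \<eta>" if "i < n" "j < n" for i j
  proof -
    have "cmod (G i j - M i j) =
        cmod (da_kernel (x i) (x j) - l j * cnj (l i) * da_kernel (y i) (y j)) / (s i * s j)"
      using s(1)[OF that(1)] s(1)[OF that(2)]
      by (simp only: G_def M_def flip: diff_divide_distrib) (simp add: norm_divide norm_mult)
    also have "\<dots> \<le> \<eta>"
      using close[OF that] s(1)[OF that(1)] s(1)[OF that(2)] by (simp add: s_def pos_divide_le_eq)
    finally show ?thesis .
  qed
  have Gsq: "(cmod (G i j))\<^sup>2 = 1 - (rho_ph (x i) (x j))\<^sup>2" if "i < n" "j < n" for i j
    using normalized_da_kernel_sq[OF x[OF that(1)] x[OF that(2)]] s(1)[OF that(1)] s(1)[OF that(2)]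
    by (simp add: G_def norm_divide norm_mult flip: s_def)
  have G1: "cmod (G i j) \<le> 1" if "i < n" "j < n" for i j
    by (rule power2_le_imp_le) (simp_all add: Gsq[OF that])
  have Gc: "sqrt (1 - r\<^sup>2) \<le> cmod (G i j)" if "i < n" "j < n" for i j
    using Gsq[OF that] power_mono[OF r(1)[OF that] rho_ph_nonneg, of 2] by (intro real_le_lsqrt) auto
  have "G 0 0 = 1" using s[OF n(1)] by (simp add: G_def flip: s(2)[OF n(1)])
  have "r \<ge> 0" using order_trans[OF rho_ph_nonneg r(1)[OF n(1,1)]] .
  then have "sqrt (1 - r\<^sup>2) > 0" using r(2) by (simp add: abs_square_less_1)
  then have "cmod (G i 0 * G 0 j / G i j - M i 0 * M 0 j / (M i j * M 0 0)) \<le> 24 * \<eta> / (sqrt (1 - r\<^sup>2))\<^sup>2"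
    using GM[OF n(1,1)] n assms(7) unfolding \<open>G 0 0 = 1\<close> by (intro ratio_perturb GM G1 Gc)
  moreover have "cinner (Psi (x 0) (x i)) (Psi (x 0) (x j)) - cinner (Psi (y 0) (y i)) (Psi (y 0) (y j)) =
      - (G i 0 * G 0 j / G i j - M i 0 * M 0 j / (M i j * M 0 0))" unfolding Gx My by simp
  ultimately show ?thesis by (simp only: norm_minus_cancel)
qed

section \<open>Bounding the invariant symmetric distance\<close>

lemma sym_dist_nonneg:
  assumes "\<And>a b. \<rho> a b \<ge> 0" "n \<ge> 1"
  shows "sym_dist \<rho> n x y \<ge> 0"
proof -
  have "(MAX i\<in>{..<n}. \<rho> (x i) (y (\<sigma> i))) \<ge> 0" for \<sigma> :: "nat \<Rightarrow> nat"
    using assms by (intro order_trans[OF assms(1) Max_ge[OF _ imageI[of 0]]]) auto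
  moreover have "{\<sigma>. \<sigma> permutes {..<n}} \<noteq> {}" using permutes_id by blast
  ultimately show ?thesis
    unfolding sym_dist_def by (subst Min_ge_iff) (auto simp: finite_permutations)
qed

lemma aut_sym_dist_leI:
  assumes "\<And>a b. \<rho> a b \<ge> 0" "n \<ge> 1" "\<Phi> \<in> Aut_ball" "\<sigma> permutes {..<n}"
    and "\<And>i. i < n \<Longrightarrow> \<rho> (x i) (\<Phi> (y (\<sigma> i))) \<le> t"
  shows "aut_sym_dist \<rho> n x y \<le> t"
proof -
  \<comment> \<open>The real \<open>INF\<close> lies below each member of the family because
    nonnegativity bounds the family from below.\<close>
  have "aut_sym_dist \<rho> n x y \<le> sym_dist \<rho> n x (\<Phi> \<circ> y)"
    unfolding aut_sym_dist_def
    by (intro cINF_lower assms bdd_belowI2[of _ 0] sym_dist_nonneg)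
  also have "\<dots> \<le> (MAX i\<in>{..<n}. \<rho> (x i) ((\<Phi> \<circ> y) (\<sigma> i)))"
    unfolding sym_dist_def using assms(4) by (intro Min_le) (auto simp: finite_permutations)
  also have "\<dots> \<le> t" using assms(2,5) by (subst Max_le_iff) (auto simp: lessThan_empty_iff)
  finally show ?thesis .
qed


text \<open>The two comparisons serve the two cases of the main estimate: \<open>e\<close> when it
  is bounded away from 0, and \<open>sqrt e\<close> when it is small.\<close>

lemma le_fourth_root:
  fixes e :: real
  assumes "0 \<le> e" "e \<le> 1"
  shows "e \<le> e powr (1 / 4)" "sqrt e \<le> e powr (1 / 4)"
  using assms powr_mono'[of "1 / 4" 1 e] powr_mono'[of "1 / 4" "1 / 2" e]
  by (simp_all add: powr_half_sqrt)

lemma aut_sym_dist_le_of_iso: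
  fixes x y :: "nat \<Rightarrow> 'd ell2"
  assumes "n \<ge> 1" "inj_on x {..<n}" "x ` {..<n} \<subseteq> ball 0 1" "inj_on y {..<n}" "y ` {..<n} \<subseteq> ball 0 1"
    and rho: "\<And>i j. i < n \<Longrightarrow> j < n \<Longrightarrow> rho_ph (x i) (x j) \<le> r" and "r < 1"
    and HX: "drury_arveson_on (x ` {..<n}) HX" and HY: "drury_arveson_on (y ` {..<n}) HY"
    and T: "rkhs_iso HX HY T"
  defines "\<delta> \<equiv> op_norm HX HY T * op_norm HY HX (inv_into (elements HX) T)"
  assumes "\<delta> < 2"
  shows "\<delta> \<ge> 1"
    and "aut_sym_dist rho_ph n x y \<le>
      7 * (4 * 3 ^ n - 2) / (sqrt (1 - r\<^sup>2) * (1 - r)) * (\<delta> - 1) powr (1 / 4)"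
proof -
  have X: "rkhs HX" "points HX = x ` {..<n}"
      "\<And>z w. z \<in> points HX \<Longrightarrow> w \<in> points HX \<Longrightarrow> kernel HX z w = da_kernel z w"
    and Y: "rkhs HY" "points HY = y ` {..<n}"
      "\<And>z w. z \<in> points HY \<Longrightarrow> w \<in> points HY \<Longrightarrow> kernel HY z w = da_kernel z w"
    using HX HY unfolding drury_arveson_on_def da_kernel_def by auto
  have n: "0 < n" using assms(1) by simp
  have x: "norm (x i) < 1" and xm: "x i \<in> points HX" if "i < n" for i using assms(3) X(2) that by auto
  have a: "x 0 \<in> points HX" "kernel HX (x 0) (x 0) \<noteq> 0"
    using xm[OF n] x[OF n] X(3) da_kernel_nonzero by auto
  have finY: "finite (points HY)" using Y(2) by simp
  show d1: "\<delta> \<ge> 1"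
    unfolding \<delta>_def by (rule rkhs_iso_kernel_close(1)[OF X(1) Y(1) finY T a])
  obtain F l where F: "bij_betw F (points HX) (points HY)" and l: "\<forall>z\<in>points HX. l z \<noteq> 0"
    and close: "\<forall>z\<in>points HX. \<forall>w\<in>points HX.
        cmod (kernel HX z w - l w * cnj (l z) * kernel HY (F z) (F w)) \<le>
        (1 - 1 / \<delta>\<^sup>2) * (sqrt (Re (kernel HX z z)) * sqrt (Re (kernel HX w w)))"
    using rkhs_iso_kernel_close(2)[OF X(1) Y(1) finY T a] unfolding \<delta>_def by blast
  \<comment> \<open>The bijection \<open>F\<close> between points, read on indices; the value
    outside the range is the one that \<open>permutes\<close> prescribes.\<close>
  define \<sigma> where "\<sigma> i = (if i < n then inv_into {..<n} y (F (x i)) else i)" for i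
  have Fm: "F (x i) \<in> y ` {..<n}" if "i < n" for i using F xm[OF that] Y(2) bij_betwE by blast
  have y\<sigma>: "y (\<sigma> i) = F (x i)" if "i < n" for i
    using Fm[OF that] that by (simp add: \<sigma>_def f_inv_into_f)
  have \<sigma>: "\<sigma> permutes {..<n}"
  proof (rule bij_imp_permutes)
    have m: "\<sigma> ` {..<n} \<subseteq> {..<n}"
      using Fm inv_into_into[of _ y "{..<n}"] by (auto simp: \<sigma>_def)
    have "inj_on (\<lambda>i. F (x i)) {..<n}"
      using comp_inj_on[OF assms(2), of F] F X(2) by (simp add: bij_betw_def comp_def)
    then have "inj_on \<sigma> {..<n}"
      using y\<sigma> unfolding inj_on_def by (metis lessThan_iff)
    then show "bij_betw \<sigma> {..<n} {..<n}"
      using m by (simp add: bij_betw_def endo_inj_surj)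
  qed (simp add: \<sigma>_def)
  define z where "z i = y (\<sigma> i)" for i
  have zm: "z i \<in> points HY" if "i < n" for i using Fm that Y(2) by (simp add: z_def y\<sigma>)
  then have z: "norm (z i) < 1" if "i < n" for i using that assms(5) Y(2) by (metis subsetD mem_ball_0)
  have r0: "0 \<le> r" using order_trans[OF rho_ph_nonneg rho[OF n n]] .
  define c h :: real where "c = sqrt (1 - r\<^sup>2)" and "h = 4 * 3 ^ n - 2"
  have c: "0 < c" "c \<le> 1" using r0 \<open>r < 1\<close> by (auto simp: c_def abs_square_less_1)
  have "(1 :: real) \<le> 3 ^ n" by simp
  then have h: "2 \<le> h" unfolding h_def by linarith
  \<comment> \<open>The 7 bounds \<open>sqrt 48\<close>, where 48 is 24 from the Gram estimate times
    2 from \<open>1 - 1 / \<delta>\<^sup>2 \<le> 2 * e\<close>. The factor \<open>h\<close> comes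
    from the unitary alignment and \<open>1 - r\<close> from \<open>rho_ph_le\<close>.\<close>
  define C where "C = 7 * h / (c * (1 - r))"
  have C: "14 / c \<le> C"
    unfolding C_def using c h r0 \<open>r < 1\<close> by (intro frac_le) (auto simp: mult_left_le)
  then have C0: "0 \<le> C" using c by (meson divide_nonneg_pos order_trans zero_le_numeral)
  define e where "e = \<delta> - 1"
  have e: "0 \<le> e" "e \<le> 1" using d1 \<open>\<delta> < 2\<close> by (simp_all add: e_def)
  have "\<exists>\<Phi>\<in>Aut_ball. \<forall>i<n. rho_ph (x i) (\<Phi> (z i)) \<le> C * e powr (1 / 4)"
  proof (cases "4 * e \<le> c")
    \<comment> \<open>This is the smallness condition of \<open>cinner_Psi_close\<close> for the
      error \<open>2 * e\<close>.\<close>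
    case True
    have "1 - 1 / \<delta>\<^sup>2 \<le> 2 * e"
    proof -
      have "\<delta> + 1 \<le> 2 * \<delta>\<^sup>2" using d1 self_le_power[of \<delta> 2] by simp
      then have "(\<delta> - 1) * (\<delta> + 1) \<le> (\<delta> - 1) * (2 * \<delta>\<^sup>2)" using d1 by (intro mult_left_mono) auto
      then show ?thesis using d1 by (simp add: e_def field_simps power2_eq_square)
    qed
    then have close': "cmod (da_kernel (x i) (x j) - l (x j) * cnj (l (x i)) * da_kernel (z i) (z j)) \<le>
      (2 * e) * (sqrt (Re (da_kernel (x i) (x i))) * sqrt (Re (da_kernel (x j) (x j))))"
      if "i < n" "j < n" for i j
    proof -
      have "cmod (da_kernel (x i) (x j) - l (x j) * cnj (l (x i)) * da_kernel (z i) (z j)) \<le>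
        (1 - 1 / \<delta>\<^sup>2) * (sqrt (Re (da_kernel (x i) (x i))) * sqrt (Re (da_kernel (x j) (x j))))"
        using close[rule_format, OF xm[OF that(1)] xm[OF that(2)]] that zm
        by (simp add: X(3) Y(3) xm flip: y\<sigma> z_def)
      also have "\<dots> \<le> (2 * e) * (sqrt (Re (da_kernel (x i) (x i))) * sqrt (Re (da_kernel (x j) (x j))))"
        using \<open>1 - 1 / \<delta>\<^sup>2 \<le> 2 * e\<close> x[OF that(1)] x[OF that(2)]
        by (intro mult_right_mono mult_nonneg_nonneg) (auto simp: da_kernel_self abs_square_le_1)
      finally show ?thesis .
    qed
    have lx: "l (x i) \<noteq> 0" if "i < n" for i using l xm that by blast
    define \<epsilon> where "\<epsilon> = 24 * (2 * e) / c\<^sup>2"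
    have gram: "cmod (cinner (Psi (x 0) (x i)) (Psi (x 0) (x j)) - cinner (Psi (z 0) (z i)) (Psi (z 0) (z j)))
      \<le> \<epsilon>" if "i < n" "j < n" for i j
      unfolding \<epsilon>_def c_def using True c_def
      by (intro cinner_Psi_close[where n = n and l = "\<lambda>i. l (x i)"] x z lx close' rho \<open>r < 1\<close> n that) auto
    obtain U where U: "unitary U"
      "\<And>i. i < n \<Longrightarrow> norm (Psi (x 0) (x i) - U (Psi (z 0) (z i))) \<le> (4 * 3 ^ n - 2) * sqrt \<epsilon>"
      using unitary_of_gram_close[of n "\<lambda>i. Psi (x 0) (x i)" "\<lambda>i. Psi (z 0) (z i)" \<epsilon>] gram by blast
    have "rho_ph (x i) (Psi (x 0) (U (Psi (z 0) (z i)))) \<le> C * e powr (1 / 4)" if i: "i < n" for i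
    proof -
      have u: "norm (U (Psi (z 0) (z i))) < 1"
        using unitary_norm[OF U(1)] norm_Psi_less_1[OF z[OF n] z[OF i]] by simp
      \<comment> \<open>Applying the involution \<open>Psi (x 0)\<close> to both arguments keeps the
        distance and strips the outer map from the second.\<close>
      have "rho_ph (x i) (Psi (x 0) (U (Psi (z 0) (z i)))) =
          rho_ph (Psi (x 0) (x i)) (Psi (x 0) (Psi (x 0) (U (Psi (z 0) (z i)))))"
        using x[OF n] x[OF i] u by (intro rho_ph_Psi[symmetric] norm_Psi_less_1)
      also have "\<dots> = rho_ph (Psi (x 0) (x i)) (U (Psi (z 0) (z i)))"
        using x[OF n] u by (simp add: Psi_Psi)
      also have "\<dots> \<le> norm (Psi (x 0) (x i) - U (Psi (z 0) (z i))) / (1 - r)"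
        using rho[OF i n] u \<open>r < 1\<close> by (intro rho_ph_le) (auto simp: rho_ph_def)
      also have "\<dots> \<le> (h * sqrt \<epsilon>) / (1 - r)"
        using U(2)[OF i] \<open>r < 1\<close> by (intro divide_right_mono) (auto simp: h_def)
      also have "\<dots> \<le> (h * (7 / c * e powr (1 / 4))) / (1 - r)"
      proof -
        have "sqrt \<epsilon> \<le> sqrt ((7 / c)\<^sup>2 * e)"
          using e c by (intro real_sqrt_le_mono) (simp add: \<epsilon>_def power_divide divide_right_mono)
        also have "\<dots> = 7 / c * sqrt e" using c by (simp add: real_sqrt_mult)
        also have "\<dots> \<le> 7 / c * e powr (1 / 4)"
          using le_fourth_root(2)[OF e] c by (intro mult_left_mono) auto
        finally show ?thesis using h \<open>r < 1\<close> by (intro divide_right_mono mult_left_mono) auto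
      qed
      also have "\<dots> = C * e powr (1 / 4)" by (simp add: C_def)
      finally show ?thesis .
    qed
    then show ?thesis
      using Psi_unitary_Psi_in_Aut_ball[OF x[OF n] z[OF n] U(1)] by (intro bexI) auto
  next
    \<comment> \<open>Now \<open>e\<close> exceeds \<open>c / 4\<close>, so the right-hand side is
      at least 1 and any automorphism will do; \<open>Psi (x 0)\<close> applied twice is the
      identity on the ball.\<close>
    case False
    have "1 \<le> C * e powr (1 / 4)"
    proof -
      have "14 / c * (c / 4) \<le> C * e powr (1 / 4)"
        using C C0 c False le_fourth_root(1)[OF e] by (intro mult_mono) auto
      then show ?thesis using c by simp
    qed
    moreover have "rho_ph (x i) (Psi (x 0) (Psi (x 0) (z i))) < 1" if "i < n" for i
      using x[OF n] x[OF that] z[OF that] by (simp add: rho_ph_less_1 Psi_Psi)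
    ultimately show ?thesis
      using Psi_unitary_Psi_in_Aut_ball[OF x[OF n] x[OF n] unitary_id]
      by (intro bexI) (auto intro: less_imp_le less_le_trans)
  qed
  then obtain \<Phi> where "\<Phi> \<in> Aut_ball" "\<And>i. i < n \<Longrightarrow> rho_ph (x i) (\<Phi> (y (\<sigma> i))) \<le> C * e powr (1 / 4)"
    unfolding z_def by blast
  then have "aut_sym_dist rho_ph n x y \<le> C * e powr (1 / 4)"
    using assms(1) \<sigma> by (intro aut_sym_dist_leI rho_ph_nonneg)
  then show "aut_sym_dist rho_ph n x y \<le>
      7 * (4 * 3 ^ n - 2) / (sqrt (1 - r\<^sup>2) * (1 - r)) * (\<delta> - 1) powr (1 / 4)"
    by (simp add: C_def c_def h_def e_def)
qed

theorem proposition5p3: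
  fixes n :: nat and r :: real
  assumes "n \<ge> 1"
  shows "\<exists>C>0. \<forall>(x :: nat \<Rightarrow> 'd::countable ell2) y HX HY.
    inj_on x {..<n} \<and> x ` {..<n} \<subseteq> ball 0 1 \<and>
    r = (MAX (i, j)\<in>{..<n} \<times> {..<n}. rho_ph (x i) (x j)) \<and>
    inj_on y {..<n} \<and> y ` {..<n} \<subseteq> ball 0 1 \<and>
    drury_arveson_on (x ` {..<n}) HX \<and> drury_arveson_on (y ` {..<n}) HY \<and>
    delta_RK HX HY < 2 \<longrightarrow>
    aut_sym_dist rho_ph n x y \<le> C * (real_of_ereal (delta_RK HX HY) - 1) powr (1 / 4)"
proof -
  define C where "C = 7 * (4 * 3 ^ n - 2) / (sqrt (1 - r\<^sup>2) * (1 - r))"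
  have main: "0 < C \<and> aut_sym_dist rho_ph n x y \<le> C * (real_of_ereal (delta_RK HX HY) - 1) powr (1 / 4)"
    if "inj_on x {..<n}" and x: "x ` {..<n} \<subseteq> ball 0 1"
    and r: "r = (MAX (i, j)\<in>{..<n} \<times> {..<n}. rho_ph (x i) (x j))"
    and "inj_on y {..<n}" "y ` {..<n} \<subseteq> ball 0 1"
    and "drury_arveson_on (x ` {..<n}) HX" "drury_arveson_on (y ` {..<n}) HY"
    and delta: "delta_RK HX HY < 2"
    for x y :: "nat \<Rightarrow> 'd ell2" and HX HY
  proof -
    let ?R = "(\<lambda>(i, j). rho_ph (x i) (x j)) ` ({..<n} \<times> {..<n})"
    have ne: "finite ?R" "?R \<noteq> {}" using assms by (auto simp: lessThan_empty_iff)
    have rho: "rho_ph (x i) (x j) \<le> r" if "i < n" "j < n" for i j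
      unfolding r using ne that by (intro Max_ge) auto
    have "r \<in> ?R" unfolding r using ne by (rule Max_in)
    then have r1: "0 \<le> r" "r < 1" using x rho_ph_nonneg by (auto intro!: rho_ph_less_1)
    have "(1 :: real) \<le> 3 ^ n" by simp
    then have "4 * 3 ^ n - (2 :: real) > 0" by linarith
    moreover have "1 - r\<^sup>2 > 0" using r1 by (simp add: abs_square_less_1)
    ultimately have C: "C > 0"
      unfolding C_def using r1 by (intro divide_pos_pos mult_pos_pos) auto
    define p where "p T = op_norm HX HY T * op_norm HY HX (inv_into (elements HX) T)" for T
    have iso: "1 \<le> p T" "aut_sym_dist rho_ph n x y \<le> C * (p T - 1) powr (1 / 4)"
      if "rkhs_iso HX HY T" "p T < 2" for T
      using aut_sym_dist_le_of_iso[OF assms \<open>inj_on x _\<close> x \<open>inj_on y _\<close> \<open>y ` _ \<subseteq> _\<close> rho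
        \<open>r < 1\<close> \<open>drury_arveson_on (x ` _) HX\<close> \<open>drury_arveson_on (y ` _) HY\<close> that(1)] that(2)
      by (simp_all add: p_def C_def)
    have delta_eq: "delta_RK HX HY = (INF T\<in>{T. rkhs_iso HX HY T}. ereal (p T))"
      by (simp add: delta_RK_def p_def)
    have "1 \<le> delta_RK HX HY"
      unfolding delta_eq
    proof (rule INF_greatest)
      fix T assume "T \<in> {T. rkhs_iso HX HY T}"
      then show "1 \<le> ereal (p T)" using iso(1)[of T] by (cases "p T < 2") auto
    qed
    with delta obtain d where d: "delta_RK HX HY = ereal d" "1 \<le> d" "d < 2"
      by (cases "delta_RK HX HY") auto
    \<comment> \<open>The infimum over isomorphisms may not be attained, so the bound is proved for
      every \<open>t\<close> above it. Permutation and automorphism may vary with \<open>t\<close>,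
      since only the numerical inequality passes to the limit.\<close>
    have le: "aut_sym_dist rho_ph n x y \<le> C * (t - 1) powr (1 / 4)" if "d < t" "t < 2" for t
    proof -
      have "delta_RK HX HY < ereal t" using that d by simp
      then obtain T where T: "rkhs_iso HX HY T" "p T < t"
        unfolding delta_eq INF_less_iff by auto
      then have "C * (p T - 1) powr (1 / 4) \<le> C * (t - 1) powr (1 / 4)"
        using iso(1)[of T] that C by (intro mult_left_mono powr_mono2) auto
      then show ?thesis using iso(2)[of T] T that by simp
    qed
    have "aut_sym_dist rho_ph n x y \<le> C * (d - 1) powr (1 / 4)"
    proof (rule tendsto_lowerbound)
      \<comment> \<open>For \<open>d = 1\<close> the base tends to 0, where continuity of
        \<open>powr\<close> relies on \<open>t - 1\<close> being nonnegative to the right of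
        \<open>d\<close>.\<close>
      show "((\<lambda>t. C * (t - 1) powr (1 / 4)) \<longlongrightarrow> C * (d - 1) powr (1 / 4)) (at_right d)"
        using d(2) by (intro tendsto_intros tendsto_powr') (auto simp: eventually_at_filter)
      show "\<forall>\<^sub>F t in at_right d. aut_sym_dist rho_ph n x y \<le> C * (t - 1) powr (1 / 4)"
        using le d(3) by (auto simp: eventually_at_right[OF d(3)])
    qed simp
    then show ?thesis using C d(1) by simp
  qed
  show ?thesis
  proof (cases "C > 0")
    case True
    then show ?thesis using main by (intro exI[of _ C]) blast
  next
    \<comment> \<open>By \<open>main\<close>, any admissible pair of configurations with this
      \<open>r\<close> would force \<open>C > 0\<close>. So there is none, and the claim is
      vacuous.\<close>
    case False
    then show ?thesis using main by (intro exI[of _ 1] conjI allI impI) (simp, blast)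
  qed
qed

end
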